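(* Let $H$ be a bipartite graph and $\alpha:E(H)\to\{0,1\}$ a $2$-edge-colouring such that $(H,\alpha)$ is complex-norming. Then $\alpha$ is transitive: $\alpha$ is balanced (every vertex is incident to equally many edges of each colour), and for any two edges $a,b$ of the same colour (resp. of opposite colours) there is an automorphism of $H$ that maps $a$ to $b$ and preserves (resp. reverses) the colours of all edges.
   Context: $\mathcal{F}_{\mathbb{C}}$ is the complex vector space of bounded measurable $f:[0,1]^2\to\mathbb{C}$. $H$ is finite, nonempty, without isolated vertices, with fixed bipartition $A\cup B$ and edges $(u,v)$, $u\in A$, $v\in B$; automorphisms of $H$ map $A$ to $A$ and $B$ to $B$. With variables $x_u$ ($u\in A$), $y_v$ ($v\in B$) in $[0,1]$ and Lebesgue measure, $t_{H,\alpha}(f)=\int\prod_{e=(u,v)\in E(H)}f(x_u,y_v)^{\alpha(e)}\overline{f(x_u,y_v)}^{1-\alpha(e)}$. $(H,\alpha)$ is complex-norming if $|t_{H,\alpha}(\cdot)|^{1/|E(H)|}$ is a seminorm on $\mathcal{F}_{\mathbb{C}}$ vanishing only on functions that are $0$ a.e. An automorphism preserves colours if it maps each edge to an edge of the same colour, and reverses colours if it maps each edge to an edge of the other colour. *)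

theory Defs
  imports "HOL-Analysis.Analysis"
begin

definition unit_interval :: "real measure" where
  "unit_interval = restrict_space lborel {0..1}"

definition unit_square :: "(real \<times> real) measure" where
  "unit_square = restrict_space lborel ({0..1} \<times> {0..1})"

text \<open>
  Functions on the unit square are represented by functions on the whole plane whose values outside
  the square are irrelevant. Measurability is Borel measurability. Every bounded Lebesgue measurable
  function agrees almost everywhere with a bounded Borel one, and the densities below only see
  functions up to null sets, so this choice does not affect which graphs are complex-norming.
\<close>

definition bounded_measurable_fns :: "(real \<times> real \<Rightarrow> complex) set" where
  "bounded_measurable_fns =
     {f \<in> borel_measurable unit_square. bounded (f ` ({0..1} \<times> {0..1}))}"

text \<open>
  A bipartite graph is given by its two vertex classes and its set of edges, each edge being written
  with its endpoint in the first class first.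
\<close>

definition bipartite_graph :: "'v set \<Rightarrow> 'v set \<Rightarrow> ('v \<times> 'v) set \<Rightarrow> bool" where
  "bipartite_graph A B E \<longleftrightarrow>
     finite A \<and> finite B \<and> A \<inter> B = {} \<and> A \<union> B \<noteq> {} \<and> E \<subseteq> A \<times> B \<and>
     (\<forall>w\<in>A \<union> B. \<exists>e\<in>E. w = fst e \<or> w = snd e)"

definition automorphism ::
  "'v set \<Rightarrow> 'v set \<Rightarrow> ('v \<times> 'v) set \<Rightarrow> ('v \<Rightarrow> 'v) \<Rightarrow> bool" where
  "automorphism A B E \<phi> \<longleftrightarrow>
     bij_betw \<phi> A A \<and> bij_betw \<phi> B B \<and>
     (\<forall>u\<in>A. \<forall>v\<in>B. (\<phi> u, \<phi> v) \<in> E \<longleftrightarrow> (u, v) \<in> E)"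

text \<open>
  The variables \<open>x\<^sub>u\<close> (\<open>u \<in> A\<close>) and \<open>y\<^sub>v\<close> (\<open>v \<in> B\<close>) form one family indexed by the disjoint union of
  the two vertex classes. The colouring takes values in \<open>{0, 1}\<close>, so for each edge exactly one of
  the two powers is the trivial factor 1.
\<close>

definition hom_density ::
  "'v set \<Rightarrow> 'v set \<Rightarrow> ('v \<times> 'v) set \<Rightarrow> ('v \<times> 'v \<Rightarrow> nat) \<Rightarrow> (real \<times> real \<Rightarrow> complex) \<Rightarrow> complex" where
  "hom_density A B E \<alpha> f =
     (\<integral>x. (\<Prod>e\<in>E. f (x (fst e), x (snd e)) ^ \<alpha> e * cnj (f (x (fst e), x (snd e))) ^ (1 - \<alpha> e))
        \<partial>PiM (A \<union> B) (\<lambda>_. unit_interval))"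

definition complex_seminorm_on :: "('s \<Rightarrow> complex) set \<Rightarrow> (('s \<Rightarrow> complex) \<Rightarrow> real) \<Rightarrow> bool" where
  "complex_seminorm_on V p \<longleftrightarrow>
     (\<forall>f\<in>V. 0 \<le> p f) \<and>
     (\<forall>f\<in>V. \<forall>c. p (\<lambda>z. c * f z) = cmod c * p f) \<and>
     (\<forall>f\<in>V. \<forall>g\<in>V. p (\<lambda>z. f z + g z) \<le> p f + p g)"

definition complex_norming ::
  "'v set \<Rightarrow> 'v set \<Rightarrow> ('v \<times> 'v) set \<Rightarrow> ('v \<times> 'v \<Rightarrow> nat) \<Rightarrow> bool" where
  "complex_norming A B E \<alpha> \<longleftrightarrow>
     (let p = (\<lambda>f. cmod (hom_density A B E \<alpha> f) powr (1 / real (card E))) in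
      complex_seminorm_on bounded_measurable_fns p \<and>
      (\<forall>f\<in>bounded_measurable_fns. p f = 0 \<longrightarrow> (AE z in unit_square. f z = 0)))"

definition balanced ::
  "'v set \<Rightarrow> 'v set \<Rightarrow> ('v \<times> 'v) set \<Rightarrow> ('v \<times> 'v \<Rightarrow> nat) \<Rightarrow> bool" where
  "balanced A B E \<alpha> \<longleftrightarrow>
     (\<forall>w\<in>A \<union> B. card {e \<in> E. (w = fst e \<or> w = snd e) \<and> \<alpha> e = 0}
             = card {e \<in> E. (w = fst e \<or> w = snd e) \<and> \<alpha> e = 1})"

definition preserves_colours ::
  "('v \<times> 'v) set \<Rightarrow> ('v \<times> 'v \<Rightarrow> nat) \<Rightarrow> ('v \<Rightarrow> 'v) \<Rightarrow> bool" where
  "preserves_colours E \<alpha> \<phi> \<longleftrightarrow> (\<forall>e\<in>E. \<alpha> (map_prod \<phi> \<phi> e) = \<alpha> e)"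

definition reverses_colours ::
  "('v \<times> 'v) set \<Rightarrow> ('v \<times> 'v \<Rightarrow> nat) \<Rightarrow> ('v \<Rightarrow> 'v) \<Rightarrow> bool" where
  "reverses_colours E \<alpha> \<phi> \<longleftrightarrow> (\<forall>e\<in>E. \<alpha> (map_prod \<phi> \<phi> e) \<noteq> \<alpha> e)"

definition transitive_colouring ::
  "'v set \<Rightarrow> 'v set \<Rightarrow> ('v \<times> 'v) set \<Rightarrow> ('v \<times> 'v \<Rightarrow> nat) \<Rightarrow> bool" where
  "transitive_colouring A B E \<alpha> \<longleftrightarrow>
     balanced A B E \<alpha> \<and>
     (\<forall>a\<in>E. \<forall>b\<in>E.
        (\<alpha> a = \<alpha> b \<longrightarrow>
           (\<exists>\<phi>. automorphism A B E \<phi> \<and> map_prod \<phi> \<phi> a = b \<and> preserves_colours E \<alpha> \<phi>)) \<and>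
        (\<alpha> a \<noteq> \<alpha> b \<longrightarrow>
           (\<exists>\<phi>. automorphism A B E \<phi> \<and> map_prod \<phi> \<phi> a = b \<and> reverses_colours E \<alpha> \<phi>)))"

end

theory Submission imports Defs begin

text \<open>
  For step functions \<open>f\<close> the density is a finite sum over maps of the vertices into an index set.
  It is multilinear up to conjugation, with one slot per edge; for an edge \<open>a\<close> let
  \<open>\<lambda>\<^sub>a(g)\<close> be the value with \<open>g\<close> in slot \<open>a\<close> and \<open>f\<close> elsewhere, divided by
  the density of \<open>f\<close> and conjugated if \<open>a\<close> has colour 0. The directional derivative of the norm at
  \<open>f\<close> bounds the real part of \<open>\<Sum>\<^sub>a \<lambda>\<^sub>a(g)\<close>. Applied to tensor powers this bounds all
  power sums of the \<open>\<lambda>\<^sub>a(g)\<close>, so every \<open>\<lambda>\<^sub>a\<close> is a support functional at \<open>f\<close>. As the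
  norm is differentiable at \<open>f\<close>, all \<open>\<lambda>\<^sub>a\<close> agree. Balancedness follows by testing
  unimodular functions of one coordinate, and it makes logarithmic derivatives of the density real, so
  the density is real. Hence the densities with \<open>g\<close> at \<open>a\<close> or at \<open>b\<close> coincide up to
  conjugation. Taking the vertices as index set, \<open>g\<close> concentrated on \<open>a\<close> and \<open>f\<close> supported on
  the edges, a coefficient of this identity (isolated by averaging over cube roots of unity) counts
  the colour-compatible automorphisms between \<open>a\<close> and \<open>b\<close>.
\<close>

section \<open>Step functions\<close>

lemma unit_interval_simps [simp]:
  "space unit_interval = {0..1}" "sets unit_interval = sets (restrict_space borel {0..1})"
  by (simp_all add: unit_interval_def space_restrict_space sets_restrict_space)

lemma finite_measure_unit_interval: "finite_measure unit_interval"
  by (rule finite_measureI) (simp add: unit_interval_def space_restrict_space emeasure_restrict_space)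

text \<open>For \<open>n > 0\<close> the reduction modulo \<open>n\<close> keeps the index below
  \<open>n\<close> for every real argument. Inside the unit interval it affects only the endpoint 1,
  which lands in cell 0 and is a null set.\<close>

definition grid :: "nat \<Rightarrow> real \<Rightarrow> nat" where
  "grid n x = nat \<lfloor>real n * x\<rfloor> mod n"

lemma measurable_grid [measurable]: "grid n \<in> borel \<rightarrow>\<^sub>M count_space UNIV"
  unfolding grid_def by measurable

lemma grid_eqI:
  assumes "k < n" "real k / real n \<le> x" "x < (real k + 1) / real n"
  shows "grid n x = k"
proof -
  have "\<lfloor>real n * x\<rfloor> = int k"
    using assms by (intro floor_unique) (auto simp: field_simps)
  then show ?thesis using assms(1) by (simp add: grid_def)
qed

lemma grid_eqD:
  assumes "k < n" "0 \<le> x" "x < 1" "grid n x = k"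
  shows "real k / real n \<le> x" "x < (real k + 1) / real n"
proof -
  have fl: "0 \<le> \<lfloor>real n * x\<rfloor>" using assms by simp
  have "real n * x < real n" using assms by simp
  then have "\<lfloor>real n * x\<rfloor> < int n" by (simp add: floor_less_iff)
  then have "nat \<lfloor>real n * x\<rfloor> < n" using fl by linarith
  then have "nat \<lfloor>real n * x\<rfloor> = k" using assms(4) by (simp add: grid_def)
  then have "\<lfloor>real n * x\<rfloor> = int k" using fl by linarith
  then have "real k \<le> real n * x \<and> real n * x < real k + 1" by linarith
  then show "real k / real n \<le> x" "x < (real k + 1) / real n"
    using assms(1) by (auto simp: field_simps)
qed

lemma grid_cell_bounds:
  assumes "k < n"
  shows "0 \<le> real k / real n" "(real k + 1) / real n \<le> 1"
  using assms by (simp_all add: field_simps)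

lemma measure_grid:
  assumes "k < n"
  shows "measure unit_interval {x\<in>{0..1}. grid n x = k} = 1 / real n"
proof -
  let ?J = "{real k / real n ..< (real k + 1) / real n}"
  have [measurable]: "{x\<in>{0..1}. grid n x = k} \<in> sets borel" by measurable
  have J: "?J \<subseteq> {0..1}"
    using grid_cell_bounds[OF assms] by (intro subsetI, unfold atLeastAtMost_iff atLeastLessThan_iff) linarith
  have "measure unit_interval {x\<in>{0..1}. grid n x = k} = measure lborel {x\<in>{0..1}. grid n x = k}"
    unfolding unit_interval_def by (rule measure_restrict_space) (auto)
  also have "\<dots> = measure lborel ?J"
  proof (rule measure_eq_AE)
    have "AE x in lborel. x \<noteq> (1::real)" by (rule AE_lborel_singleton)
    then show "AE x in lborel. x \<in> {x \<in> {0..1}. grid n x = k} \<longleftrightarrow> x \<in> ?J"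
    proof eventually_elim
      case (elim x)
      show ?case
      proof
        assume "x \<in> {x \<in> {0..1}. grid n x = k}"
        then have "0 \<le> x" "x < 1" "grid n x = k" using elim by auto
        then show "x \<in> ?J" using grid_eqD[OF assms, of x] by simp
      next
        assume "x \<in> ?J"
        then show "x \<in> {x \<in> {0..1}. grid n x = k}" using J grid_eqI[OF assms, of x] by auto
      qed
    qed
  qed auto
  also have "\<dots> = 1 / real n" using assms by (simp add: field_simps)
  finally show ?thesis .
qed

lemma grid_interval:
  assumes "k < n"
  obtains l u where "l < u" "{l<..<u} \<subseteq> {0..1}" "\<And>x. x \<in> {l<..<u} \<Longrightarrow> grid n x = k"
proof
  show "real k / real n < (real k + 1) / real n" using assms by (simp add: divide_strict_right_mono)
  show "{real k / real n<..<(real k + 1) / real n} \<subseteq> {0..1}"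
    using grid_cell_bounds[OF assms]
    by (intro subsetI, unfold atLeastAtMost_iff greaterThanLessThan_iff) linarith
  show "grid n x = k" if "x \<in> {real k / real n<..<(real k + 1) / real n}" for x
    using that by (intro grid_eqI assms) auto
qed

section \<open>Conjugation by colour, and densities of step functions as finite sums\<close>

definition conj_if :: "bool \<Rightarrow> complex \<Rightarrow> complex" where
  "conj_if b z = (if b then cnj z else z)"

lemma conj_if_simps [simp]:
  "conj_if b 0 = 0" "conj_if b 1 = 1" "conj_if b (x + y) = conj_if b x + conj_if b y"
  "conj_if b (x / y) = conj_if b x / conj_if b y"
  "conj_if b (x ^ n) = conj_if b x ^ n" "conj_if b (of_real r) = of_real r"
  "cmod (conj_if b x) = cmod x" "conj_if b x = 0 \<longleftrightarrow> x = 0"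
  "conj_if b (conj_if c x) = conj_if (b \<noteq> c) x" "conj_if False x = x"
  by (simp_all add: conj_if_def)

lemma conj_if_mult [simp]: "conj_if b (x * y) = conj_if b x * conj_if b y"
  by (simp add: conj_if_def)

lemma Re_conj_if [simp]: "Re (conj_if b x) = Re x"
  by (simp add: conj_if_def)

lemma conj_if_sum: "conj_if b (sum f S) = (\<Sum>x\<in>S. conj_if b (f x))"
  by (simp add: conj_if_def)

lemma conj_if_prod: "conj_if b (prod f S) = (\<Prod>x\<in>S. conj_if b (f x))"
  by (simp add: conj_if_def)

locale coloured_bigraph =
  fixes A B :: "'v set" and E :: "('v \<times> 'v) set" and \<alpha> :: "'v \<times> 'v \<Rightarrow> nat"
  assumes bip: "bipartite_graph A B E"
    and col: "\<alpha> \<in> E \<rightarrow> {0, 1}"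
begin

text \<open>The unnormalised homomorphism sum with a separate function for each edge. It is complex
  linear in the slots of colour 1 and antilinear in those of colour 0.\<close>

definition multi_hom :: "'i set \<Rightarrow> ('v \<times> 'v \<Rightarrow> 'i \<Rightarrow> 'i \<Rightarrow> complex) \<Rightarrow> complex" where
  "multi_hom I F = (\<Sum>\<phi>\<in>PiE (A \<union> B) (\<lambda>_. I).
     \<Prod>e\<in>E. conj_if (\<alpha> e = 0) (F e (\<phi> (fst e)) (\<phi> (snd e))))"

abbreviation hom_sum :: "'i set \<Rightarrow> ('i \<Rightarrow> 'i \<Rightarrow> complex) \<Rightarrow> complex" where
  "hom_sum I f \<equiv> multi_hom I (\<lambda>_. f)"

lemma finite_AB: "finite (A \<union> B)" and finite_E: "finite E"
  and E_sub: "E \<subseteq> A \<times> B" and AB_disj: "A \<inter> B = {}"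
proof -
  show "finite (A \<union> B)" "E \<subseteq> A \<times> B" "A \<inter> B = {}" using bip by (auto simp: bipartite_graph_def)
  then show "finite E" by (meson finite_SigmaI finite_Un finite_subset)
qed

lemma E_nonempty: "E \<noteq> {}"
  using bip by (force simp: bipartite_graph_def)

lemma card_E_pos: "card E > 0"
  using finite_E E_nonempty by (simp add: card_gt_0_iff)

lemma col_cases: "e \<in> E \<Longrightarrow> \<alpha> e = 0 \<or> \<alpha> e = 1"
  using col by auto

lemma edge_ends: "e \<in> E \<Longrightarrow> fst e \<in> A \<union> B" "e \<in> E \<Longrightarrow> snd e \<in> A \<union> B"
  using E_sub by auto

lemma finite_maps: "finite I \<Longrightarrow> finite (PiE (A \<union> B) (\<lambda>_. I))"
  using finite_AB by (intro finite_PiE) auto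

text \<open>The cells of \<open>c\<close> split the cube of all vertex variables into product cells
  indexed by the maps from vertices to \<open>I\<close>. The integrand is constant on each product
  cell, and all of them have measure \<open>r ^ card (A \<union> B)\<close>.\<close>

lemma hom_density_step:
  fixes c :: "real \<Rightarrow> 'i" and f :: "'i \<Rightarrow> 'i \<Rightarrow> complex"
  assumes I: "finite I" and cI: "\<And>x. c x \<in> I"
    and meas: "\<And>i. i \<in> I \<Longrightarrow> {x. c x = i} \<in> sets borel"
    and r: "\<And>i. i \<in> I \<Longrightarrow> measure unit_interval {x\<in>{0..1}. c x = i} = r"
  shows "hom_density A B E \<alpha> (\<lambda>z. f (c (fst z)) (c (snd z))) = of_real r ^ card (A \<union> B) * hom_sum I f"
proof -
  interpret U: finite_measure unit_interval by (rule finite_measure_unit_interval)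
  interpret product_sigma_finite "\<lambda>_::'v. unit_interval"
    by standard
  let ?V = "A \<union> B"
  let ?term = "\<lambda>\<phi>. \<Prod>e\<in>E. conj_if (\<alpha> e = 0) (f (\<phi> (fst e)) (\<phi> (snd e)))"
  let ?S = "\<lambda>i. {x\<in>{0..1}. c x = i}"
  have S: "?S i \<in> sets unit_interval" if "i \<in> I" for i
    using meas[OF that] by (auto simp: sets_restrict_space image_iff intro!: bexI[of _ "{x. c x = i}"])
  have ind: "integrable unit_interval (indicator (?S i) :: real \<Rightarrow> complex)"
    "integral\<^sup>L unit_interval (indicator (?S i)) = complex_of_real r" if "i \<in> I" for i
  proof -
    have eq: "(indicator (?S i) :: real \<Rightarrow> complex) = (\<lambda>x. of_real (indicator (?S i) x))"
      by (auto simp: indicator_def)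
    have "emeasure unit_interval (?S i) < \<infinity>"
      using U.emeasure_finite[of "?S i"] unfolding less_top by simp
    then have int: "integrable unit_interval (indicator (?S i) :: real \<Rightarrow> real)"
      using S[OF that] by (intro integrable_real_indicator)
    have "integral\<^sup>L unit_interval (indicator (?S i) :: real \<Rightarrow> real) = r"
      using S[OF that] r[OF that] by (simp add: Int_absorb2 subset_eq)
    then show "integrable unit_interval (indicator (?S i) :: real \<Rightarrow> complex)"
      "integral\<^sup>L unit_interval (indicator (?S i)) = complex_of_real r"
      unfolding eq using int by (simp_all only: integrable_of_real integral_complex_of_real)
  qed
  have intg: "integrable (PiM ?V (\<lambda>_. unit_interval))
      (\<lambda>x. \<Prod>v\<in>?V. (indicator (?S (\<phi> v)) (x v) :: complex))"
    and int: "(\<integral>x. (\<Prod>v\<in>?V. indicator (?S (\<phi> v)) (x v)) \<partial>PiM ?V (\<lambda>_. unit_interval))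
      = complex_of_real r ^ card ?V"
    if \<phi>: "\<phi> \<in> PiE ?V (\<lambda>_. I)" for \<phi>
  proof -
    have *: "\<phi> v \<in> I" if "v \<in> ?V" for v using \<phi> that by (rule PiE_mem)
    show "integrable (PiM ?V (\<lambda>_. unit_interval))
      (\<lambda>x. \<Prod>v\<in>?V. (indicator (?S (\<phi> v)) (x v) :: complex))"
      by (rule product_integrable_prod[OF finite_AB]) (use * ind in auto)
    show "(\<integral>x. (\<Prod>v\<in>?V. indicator (?S (\<phi> v)) (x v)) \<partial>PiM ?V (\<lambda>_. unit_interval))
      = complex_of_real r ^ card ?V"
      using product_integral_prod[OF finite_AB, where f="\<lambda>v. indicator (?S (\<phi> v)) :: real \<Rightarrow> complex"] * ind
      by simp
  qed
  have "hom_density A B E \<alpha> (\<lambda>z. f (c (fst z)) (c (snd z))) =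
     (\<integral>x. (\<Sum>\<phi>\<in>PiE ?V (\<lambda>_. I). ?term \<phi> * (\<Prod>v\<in>?V. indicator (?S (\<phi> v)) (x v)))
        \<partial>PiM ?V (\<lambda>_. unit_interval))"
    unfolding hom_density_def
  proof (rule Bochner_Integration.integral_cong[OF refl])
    fix x assume "x \<in> space (PiM ?V (\<lambda>_. unit_interval))"
    then have x: "x v \<in> {0..1}" if "v \<in> ?V" for v using that by (auto simp: space_PiM)
    \<comment> \<open>\<open>\<psi>\<close> records the cells that contain the coordinates of
      \<open>x\<close>. Among the extensional maps it is the only one whose product of indicators
      does not vanish at \<open>x\<close>.\<close>
    define \<psi> where "\<psi> = restrict (\<lambda>v. c (x v)) ?V"
    have \<psi>: "\<psi> \<in> PiE ?V (\<lambda>_. I)" using cI by (auto simp: \<psi>_def)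
    have prod: "(\<Prod>v\<in>?V. indicator (?S (\<phi> v)) (x v) :: complex) = (if \<phi> = \<psi> then 1 else 0)"
      if \<phi>: "\<phi> \<in> PiE ?V (\<lambda>_. I)" for \<phi>
    proof (cases "\<phi> = \<psi>")
      case True then show ?thesis using x by (auto simp: \<psi>_def indicator_def intro!: prod.neutral)
    next
      case False
      then obtain v where "v \<in> ?V" "\<phi> v \<noteq> \<psi> v" using PiE_ext[OF \<phi> \<psi>] by blast
      then show ?thesis using False finite_AB
        by (auto intro!: prod_zero bexI[of _ v] simp: \<psi>_def indicator_def simp del: Un_iff)
    qed
    have "(\<Sum>\<phi>\<in>PiE ?V (\<lambda>_. I). ?term \<phi> * (\<Prod>v\<in>?V. indicator (?S (\<phi> v)) (x v)))
      = (\<Sum>\<phi>\<in>PiE ?V (\<lambda>_. I). if \<phi> = \<psi> then ?term \<phi> else 0)"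
      by (intro sum.cong refl) (simp only: prod mult_1_right mult_zero_right if_distrib[of "(*) _"])
    also have "\<dots> = ?term \<psi>" using \<psi> finite_maps[OF I] by (simp del: PiE_iff)
    also have "\<dots> = (\<Prod>e\<in>E. f (c (fst (x (fst e), x (snd e)))) (c (snd (x (fst e), x (snd e)))) ^ \<alpha> e *
        cnj (f (c (fst (x (fst e), x (snd e)))) (c (snd (x (fst e), x (snd e))))) ^ (1 - \<alpha> e))"
    proof (rule prod.cong[OF refl])
      fix e assume "e \<in> E"
      then show "conj_if (\<alpha> e = 0) (f (\<psi> (fst e)) (\<psi> (snd e))) = f (c (fst (x (fst e), x (snd e)))) (c (snd (x (fst e), x (snd e)))) ^ \<alpha> e *
        cnj (f (c (fst (x (fst e), x (snd e)))) (c (snd (x (fst e), x (snd e))))) ^ (1 - \<alpha> e)"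
        using col_cases[of e] edge_ends[of e] by (auto simp: \<psi>_def conj_if_def)
    qed
    finally show "(\<Prod>e\<in>E. f (c (fst (x (fst e), x (snd e)))) (c (snd (x (fst e), x (snd e)))) ^ \<alpha> e *
        cnj (f (c (fst (x (fst e), x (snd e)))) (c (snd (x (fst e), x (snd e))))) ^ (1 - \<alpha> e))
       = (\<Sum>\<phi>\<in>PiE ?V (\<lambda>_. I). ?term \<phi> * (\<Prod>v\<in>?V. indicator (?S (\<phi> v)) (x v)))" by (rule sym)
  qed
  also have "\<dots> = (\<Sum>\<phi>\<in>PiE ?V (\<lambda>_. I). ?term \<phi> * complex_of_real r ^ card ?V)"
    by (subst Bochner_Integration.integral_sum)
      (simp_all only: intg int integral_mult_right_zero integrable_mult_right cong: sum.cong)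
  finally show ?thesis by (simp add: multi_hom_def sum_distrib_left mult.commute)
qed

end

section \<open>The norm on step functions\<close>

locale norming_bigraph = coloured_bigraph A B E \<alpha>
  for A B :: "'v set" and E :: "('v \<times> 'v) set" and \<alpha> :: "'v \<times> 'v \<Rightarrow> nat" +
  assumes norming: "complex_norming A B E \<alpha>"
begin

definition hnorm :: "'i set \<Rightarrow> ('i \<Rightarrow> 'i \<Rightarrow> complex) \<Rightarrow> real" where
  "hnorm I f = cmod (hom_sum I f) powr (1 / real (card E))"

text \<open>Spreading the points of \<open>I\<close> over cells of equal length turns functions on
  \<open>I \<times> I\<close> into step functions on the square. The measure of the product cells
  becomes the constant \<open>K\<close>, so the triangle inequality passes to \<open>hnorm\<close>.
  The interval inside each cell provides the positive measure needed for definiteness.\<close>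

lemma step_function_transfer:
  fixes I :: "'i set"
  assumes "finite I" "I \<noteq> {}"
  obtains c :: "real \<Rightarrow> 'i" and K :: real where "K > 0"
    "\<And>f :: 'i \<Rightarrow> 'i \<Rightarrow> complex. (\<lambda>z. f (c (fst z)) (c (snd z))) \<in> bounded_measurable_fns"
    "\<And>f. cmod (hom_density A B E \<alpha> (\<lambda>z. f (c (fst z)) (c (snd z)))) powr (1 / real (card E)) = K * hnorm I f"
    "\<And>i. i \<in> I \<Longrightarrow> \<exists>l u. l < u \<and> {l<..<u} \<subseteq> {0..1} \<and> (\<forall>x\<in>{l<..<u}. c x = i)"
proof -
  define n where "n = card I"
  have n: "n > 0" using assms by (simp add: n_def card_gt_0_iff)
  obtain \<beta> where \<beta>: "bij_betw \<beta> {0..<n} I" using ex_bij_betw_nat_finite[OF assms(1)] n_def by blast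
  define c where "c = \<beta> \<circ> grid n"
  have grid: "grid n x < n" for x using n by (simp add: grid_def)
  have cI: "c x \<in> I" for x using \<beta> grid[of x] by (auto simp: c_def bij_betw_def)
  have c_iff: "c x = \<beta> k \<longleftrightarrow> grid n x = k" if "k < n" for x k
    using \<beta> grid[of x] that by (auto simp: c_def bij_betw_def inj_on_def)
  have ex: "\<exists>k<n. i = \<beta> k" if "i \<in> I" for i using \<beta> that by (auto simp: bij_betw_def)
  have meas: "{x. c x = i} \<in> sets borel" if "i \<in> I" for i
  proof -
    obtain k where k: "k < n" "i = \<beta> k" using ex[OF \<open>i \<in> I\<close>] by blast
    have "{x. grid n x = k} \<in> sets borel" by measurable
    then show ?thesis using k by (simp add: c_iff)
  qed
  have r: "measure unit_interval {x\<in>{0..1}. c x = i} = 1 / real n" if "i \<in> I" for i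
  proof -
    obtain k where k: "k < n" "i = \<beta> k" using ex[OF \<open>i \<in> I\<close>] by blast
    then show ?thesis using measure_grid[OF k(1)] c_iff[OF k(1)] by simp
  qed
  show ?thesis
  proof (rule that)
    show "((1 / real n) ^ card (A \<union> B)) powr (1 / real (card E)) > 0" using n by simp
    show "(\<lambda>z. f (c (fst z)) (c (snd z))) \<in> bounded_measurable_fns" for f :: "'i \<Rightarrow> 'i \<Rightarrow> complex"
    proof -
      let ?s = "\<lambda>z. f (c (fst z)) (c (snd z))"
      have "(\<lambda>z. (grid n (fst z), grid n (snd z))) \<in> borel \<Otimes>\<^sub>M borel \<rightarrow>\<^sub>M count_space UNIV \<Otimes>\<^sub>M count_space UNIV"
        by measurable
      then have "(\<lambda>z. (grid n (fst z), grid n (snd z))) \<in> borel \<rightarrow>\<^sub>M count_space UNIV"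
        by (simp add: pair_measure_countable borel_prod)
      then have "(\<lambda>z. (\<lambda>(j, k). f (\<beta> j) (\<beta> k)) (grid n (fst z), grid n (snd z))) \<in> borel \<rightarrow>\<^sub>M borel"
        by (rule measurable_compose) simp
      then have "?s \<in> borel \<rightarrow>\<^sub>M borel" by (simp add: c_def)
      then have "?s \<in> borel_measurable unit_square"
        unfolding unit_square_def by (intro measurable_restrict_space1) simp
      moreover have "?s ` ({0..1} \<times> {0..1}) \<subseteq> (\<lambda>(i, j). f i j) ` (I \<times> I)"
        using cI by (auto intro!: image_eqI[of _ _ "(c _, c _)"])
      then have "bounded (?s ` ({0..1} \<times> {0..1}))"
        using assms(1) by (meson bounded_subset finite_SigmaI finite_imageI finite_imp_bounded)
      ultimately show ?thesis by (simp add: bounded_measurable_fns_def)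
    qed
    show "cmod (hom_density A B E \<alpha> (\<lambda>z. f (c (fst z)) (c (snd z)))) powr (1 / real (card E)) =
      ((1 / real n) ^ card (A \<union> B)) powr (1 / real (card E)) * hnorm I f" for f
      using hom_density_step[OF assms(1) cI meas r, of f]
      by (simp add: hnorm_def norm_mult norm_power norm_divide flip: powr_mult)
    show "\<exists>l u. l < u \<and> {l<..<u} \<subseteq> {0..1} \<and> (\<forall>x\<in>{l<..<u}. c x = i)" if "i \<in> I" for i
    proof -
      obtain k where k: "k < n" "i = \<beta> k" using ex[OF \<open>i \<in> I\<close>] by blast
      then show ?thesis using grid_interval[OF k(1)] c_iff[OF k(1)] by metis
    qed
  qed
qed

lemma density_triangle:
  assumes "f \<in> bounded_measurable_fns" "g \<in> bounded_measurable_fns"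
  shows "cmod (hom_density A B E \<alpha> (\<lambda>z. f z + g z)) powr (1 / real (card E))
    \<le> cmod (hom_density A B E \<alpha> f) powr (1 / real (card E))
      + cmod (hom_density A B E \<alpha> g) powr (1 / real (card E))"
  using norming assms by (simp add: complex_norming_def Let_def complex_seminorm_on_def)

lemma density_definite:
  assumes "f \<in> bounded_measurable_fns" "hom_density A B E \<alpha> f = 0"
  shows "AE z in unit_square. f z = 0"
  using norming assms by (simp add: complex_norming_def Let_def)

lemma hnorm_triangle:
  fixes I :: "'i set"
  assumes "finite I" "I \<noteq> {}"
  shows "hnorm I (\<lambda>i j. f i j + g i j) \<le> hnorm I f + hnorm I g"
proof -
  obtain c K where K: "K > 0"
    and bm: "\<And>f :: 'i \<Rightarrow> 'i \<Rightarrow> complex. (\<lambda>z. f (c (fst z)) (c (snd z))) \<in> bounded_measurable_fns"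
    and hn: "\<And>f. cmod (hom_density A B E \<alpha> (\<lambda>z. f (c (fst z)) (c (snd z)))) powr (1 / real (card E)) = K * hnorm I f"
    by (rule step_function_transfer[OF assms]) blast
  have "K * hnorm I (\<lambda>i j. f i j + g i j) \<le> K * hnorm I f + K * hnorm I g"
    using density_triangle[OF bm[of f] bm[of g]] unfolding hn[symmetric] .
  then show ?thesis using K by (simp flip: distrib_left)
qed

text \<open>If the sum vanished, definiteness would make the step function zero almost everywhere,
  yet it takes the nonzero value \<open>f i j\<close> on an open rectangle of positive area.\<close>

lemma hom_sum_nonzero:
  fixes I :: "'i set"
  assumes "finite I" "i \<in> I" "j \<in> I" "f i j \<noteq> 0"
  shows "hom_sum I f \<noteq> 0"
proof
  assume zero: "hom_sum I f = 0"
  obtain c K where "K > 0"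
    and bm: "\<And>f :: 'i \<Rightarrow> 'i \<Rightarrow> complex. (\<lambda>z. f (c (fst z)) (c (snd z))) \<in> bounded_measurable_fns"
    and hn: "\<And>f. cmod (hom_density A B E \<alpha> (\<lambda>z. f (c (fst z)) (c (snd z)))) powr (1 / real (card E)) = K * hnorm I f"
    and box: "\<And>i. i \<in> I \<Longrightarrow> \<exists>l u. l < u \<and> {l<..<u} \<subseteq> {0..1} \<and> (\<forall>x\<in>{l<..<u}. c x = i)"
    by (rule step_function_transfer[of I]) (use assms in blast)+
  have "hom_density A B E \<alpha> (\<lambda>z. f (c (fst z)) (c (snd z))) = 0"
    using hn[of f] zero by (simp add: hnorm_def)
  then have "AE z in unit_square. f (c (fst z)) (c (snd z)) = 0"
    by (rule density_definite[OF bm])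
  then have ae: "AE z in lborel. z \<in> {0..1} \<times> {0..1} \<longrightarrow> f (c (fst z)) (c (snd z)) = 0"
    unfolding unit_square_def by (subst (asm) AE_restrict_space_iff) (auto intro!: borel_closed closed_Times)
  obtain l u where lu: "l < u" "{l<..<u} \<subseteq> {0..1}" "\<forall>x\<in>{l<..<u}. c x = i" using box[OF assms(2)] by blast
  obtain l' u' where lu': "l' < u'" "{l'<..<u'} \<subseteq> {0..1}" "\<forall>x\<in>{l'<..<u'}. c x = j" using box[OF assms(3)] by blast
  let ?R = "{l<..<u} \<times> {l'<..<u'}"
  have R: "?R \<in> sets lborel" by (auto intro!: borel_open open_Times)
  have "AE z in lborel. z \<notin> ?R"
    using ae
  proof eventually_elim
    case (elim z)
    show ?case
    proof
      assume z: "z \<in> ?R"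
      then have "c (fst z) = i" "c (snd z) = j" "z \<in> {0..1} \<times> {0..1}" using lu lu' by (auto simp: subset_eq)
      then show False using elim assms(4) by simp
    qed
  qed
  then have "emeasure lborel ?R = 0" using R by (subst (asm) AE_iff_measurable[OF R]) auto
  moreover have "emeasure lborel ?R = emeasure (lborel \<Otimes>\<^sub>M lborel) ?R" by (simp add: lborel_prod)
  moreover have "\<dots> = emeasure lborel {l<..<u} * emeasure lborel {l'<..<u'}"
    by (rule sigma_finite_measure.emeasure_pair_measure_Times)
      (auto intro: lborel.sigma_finite_measure_axioms)
  ultimately show False using lu(1) lu'(1) by (simp add: ennreal_mult[symmetric] flip: ennreal_0)
qed

end

section \<open>Multilinear forms and tensor powers\<close>

text \<open>By simultaneous Dirichlet approximation there are arbitrarily large exponents for which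
  the powers of all \<open>z b\<close> point close to the positive real axis together. No
  cancellation occurs for these exponents, so each \<open>cmod (z a)\<close> power is at most twice
  the bound \<open>C * N ^ k\<close>. Growth in the exponent then removes the constant.\<close>

lemma norm_le_of_power_sums_le:
  fixes z :: "'s \<Rightarrow> complex"
  assumes "finite S" "a \<in> S" "0 \<le> N"
    and le: "\<And>k. 0 < k \<Longrightarrow> Re (\<Sum>b\<in>S. z b ^ k) \<le> C * N ^ k"
  shows "cmod (z a) \<le> N"
proof (rule ccontr)
  assume "\<not> cmod (z a) \<le> N"
  then have gt: "N < cmod (z a)" by simp
  have key: "\<exists>q>0. cmod (z a) ^ (q * K) \<le> 2 * (C * N ^ (q * K))" if K: "K > 0" for K
  proof -
    obtain h where h: "bij_betw h {0..<card S} S" using ex_bij_betw_nat_finite[OF assms(1)] by blast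
    \<comment> \<open>Within 1/6 of a full turn, that is within an angle of pi/3, the cosine is at
      least 1/2. Dirichlet's theorem only gives a positive \<open>q\<close>; scaling the arguments
      by \<open>K\<close> makes the resulting exponent \<open>q * K\<close> at least
      \<open>K\<close>.\<close>
    obtain q p where q: "0 < q" and
      approx: "\<And>i. i < card S \<Longrightarrow> \<bar>of_int q * (real K * Arg (z (h i)) / (2 * pi)) - of_int (p i)\<bar> < 1 / real 6"
      by (rule Dirichlet_approx_simult[of 6 "card S" "\<lambda>i. real K * Arg (z (h i)) / (2 * pi)"]) (simp, blast)
    define Q where "Q = nat q"
    have Q: "Q > 0" "real Q = of_int q" using q by (auto simp: Q_def)
    have half: "cmod (z b) ^ (Q * K) / 2 \<le> Re (z b ^ (Q * K))" if "b \<in> S" for b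
    proof -
      obtain i where i: "i < card S" "b = h i" using h \<open>b \<in> S\<close> by (fastforce simp: bij_betw_def)
      define t where "t = real Q * (real K * Arg (z b) / (2 * pi)) - of_int (p i)"
      have "\<bar>t\<bar> < 1 / 6" using approx[OF i(1)] by (simp add: t_def Q i)
      then have "\<bar>2 * pi * t\<bar> \<le> pi / 3" by (simp add: abs_mult)
      then have "cos (pi / 3) \<le> cos \<bar>2 * pi * t\<bar>" by (intro cos_monotone_0_pi_le) auto
      then have ge: "1 / 2 \<le> cos (2 * pi * t)" by (simp add: cos_60)
      have "real (Q * K) * Arg (z b) = 2 * pi * t + 2 * pi * of_int (p i)"
        by (simp add: t_def field_simps)
      then have "cos (real (Q * K) * Arg (z b)) = cos (2 * pi * t)"
        by (simp only: cos_add cos_int_2pin sin_int_2pin mult_1_right mult_zero_right diff_zero)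
      moreover have "z b ^ (Q * K) = rcis (cmod (z b) ^ (Q * K)) (real (Q * K) * Arg (z b))"
        by (metis DeMoivre2 rcis_cmod_Arg)
      then have "Re (z b ^ (Q * K)) = cmod (z b) ^ (Q * K) * cos (real (Q * K) * Arg (z b))"
        by (simp only: Re_rcis)
      ultimately show ?thesis using mult_left_mono[OF ge, of "cmod (z b) ^ (Q * K)"] by simp
    qed
    have "cmod (z a) ^ (Q * K) / 2 \<le> (\<Sum>b\<in>S. cmod (z b) ^ (Q * K) / 2)"
      by (rule member_le_sum) (use assms in auto)
    also have "\<dots> \<le> (\<Sum>b\<in>S. Re (z b ^ (Q * K)))" by (intro sum_mono half)
    also have "\<dots> \<le> C * N ^ (Q * K)" using le[of "Q * K"] Q K by simp
    finally show ?thesis using Q by (intro exI[of _ Q]) simp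
  qed
  show False
  proof (cases "N = 0")
    case True
    obtain q where q: "q > 0" "cmod (z a) ^ (q * 1) \<le> 2 * (C * N ^ (q * 1))" using key[of 1] by auto
    have "0 < cmod (z a) ^ (q * 1)" using True gt by (intro zero_less_power) simp
    moreover have "N ^ (q * 1) = 0" using True q(1) by simp
    ultimately show False using q(2) by (simp only: mult_zero_right)
  next
    case False
    then have N: "N > 0" using assms by simp
    define r where "r = cmod (z a) / N"
    have r: "r > 1" using gt N by (simp add: r_def)
    obtain K where "2 * C < r ^ K" using real_arch_pow[OF r] by blast
    then have "2 * C < r ^ Suc K" using r by (smt (verit) power_Suc mult_le_cancel_right1 zero_less_power)
    moreover obtain q where q: "q > 0" "cmod (z a) ^ (q * Suc K) \<le> 2 * (C * N ^ (q * Suc K))"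
      using key[of "Suc K"] by auto
    then have "r ^ (q * Suc K) \<le> 2 * C" using N unfolding r_def power_divide by (simp add: divide_le_eq del: mult_Suc_right)
    moreover have "Suc K \<le> q * Suc K" using q(1) mult_le_mono1[of 1 q "Suc K"] by simp
    then have "r ^ Suc K \<le> r ^ (q * Suc K)" using r by (intro power_increasing) auto
    ultimately show False by simp
  qed
qed

section \<open>Exchanging the arguments of families of maps\<close>

lemma PiE_PiE_mem:
  "f \<in> PiE X (\<lambda>_. PiE Y (\<lambda>_. I)) \<Longrightarrow> x \<in> X \<Longrightarrow> y \<in> Y \<Longrightarrow> f x y \<in> I"
  by (drule (1) PiE_mem) (erule (1) PiE_mem)

lemma PiE_swap_mem:
  assumes "f \<in> PiE X (\<lambda>_. PiE Y (\<lambda>_. I))"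
  shows "(\<lambda>y\<in>Y. \<lambda>x\<in>X. f x y) \<in> PiE Y (\<lambda>_. PiE X (\<lambda>_. I))"
  unfolding restrict_PiE_iff using PiE_PiE_mem[OF assms] by simp

lemma PiE_swap_swap:
  assumes f: "f \<in> PiE X (\<lambda>_. PiE Y (\<lambda>_. I))"
  shows "(\<lambda>x\<in>X. \<lambda>y\<in>Y. (\<lambda>y\<in>Y. \<lambda>x\<in>X. f x y) y x) = f"
proof
  fix x show "(\<lambda>x\<in>X. \<lambda>y\<in>Y. (\<lambda>y\<in>Y. \<lambda>x\<in>X. f x y) y x) x = f x"
  proof (cases "x \<in> X")
    case True
    then have "f x \<in> PiE Y (\<lambda>_. I)" using f by (metis PiE_mem)
    then have "restrict (f x) Y = f x" by (rule PiE_restrict)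
    moreover have "(\<lambda>y\<in>Y. (\<lambda>y\<in>Y. \<lambda>x\<in>X. f x y) y x) = restrict (f x) Y"
      using True by (intro ext) (simp add: restrict_def)
    ultimately show ?thesis using True by (simp only: restrict_apply')
  next
    case False
    then show ?thesis using PiE_arb[OF f False] by (simp only: restrict_apply if_False)
  qed
qed

text \<open>With \<open>X\<close> a set of k indices and \<open>Y\<close> the vertices, this
  identifies k maps from the vertices to \<open>I\<close> with one map from the vertices to the k-th
  power of \<open>I\<close>.\<close>

lemma bij_betw_PiE_swap:
  "bij_betw (\<lambda>f. \<lambda>y\<in>Y. \<lambda>x\<in>X. f x y) (PiE X (\<lambda>_. PiE Y (\<lambda>_. I))) (PiE Y (\<lambda>_. PiE X (\<lambda>_. I)))"
  by (rule bij_betwI[where g = "\<lambda>f. \<lambda>x\<in>X. \<lambda>y\<in>Y. f y x"])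
    (rule funcsetI, erule PiE_swap_mem, rule funcsetI, erule PiE_swap_mem,
      erule PiE_swap_swap, erule PiE_swap_swap)

section \<open>Slots, derivatives and tensor powers of the multilinear form\<close>

context coloured_bigraph
begin

lemma multi_hom_cong:
  assumes "\<And>e i j. e \<in> E \<Longrightarrow> i \<in> I \<Longrightarrow> j \<in> I \<Longrightarrow> F e i j = G e i j"
  shows "multi_hom I F = multi_hom I G"
  unfolding multi_hom_def
proof (intro sum.cong prod.cong refl)
  fix \<phi> e assume "\<phi> \<in> PiE (A \<union> B) (\<lambda>_. I)" "e \<in> E"
  then have "\<phi> (fst e) \<in> I" "\<phi> (snd e) \<in> I" using edge_ends[of e] by (auto intro: PiE_mem)
  then show "conj_if (\<alpha> e = 0) (F e (\<phi> (fst e)) (\<phi> (snd e))) = conj_if (\<alpha> e = 0) (G e (\<phi> (fst e)) (\<phi> (snd e)))"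
    using assms \<open>e \<in> E\<close> by simp
qed

definition slot :: "'i set \<Rightarrow> 'v \<times> 'v \<Rightarrow> ('i \<Rightarrow> 'i \<Rightarrow> complex) \<Rightarrow> ('i \<Rightarrow> 'i \<Rightarrow> complex) \<Rightarrow> complex" where
  "slot I a f g = multi_hom I (\<lambda>e. if e = a then g else f)"

lemma slot_eq:
  assumes "a \<in> E"
  shows "slot I a f g = (\<Sum>\<phi>\<in>PiE (A \<union> B) (\<lambda>_. I). conj_if (\<alpha> a = 0) (g (\<phi> (fst a)) (\<phi> (snd a))) *
     (\<Prod>e\<in>E - {a}. conj_if (\<alpha> e = 0) (f (\<phi> (fst e)) (\<phi> (snd e)))))"
  unfolding slot_def multi_hom_def
  by (intro sum.cong refl, subst prod.remove[OF finite_E assms]) (auto intro!: prod.cong)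

lemma slot_self [simp]: "slot I a f f = hom_sum I f"
  by (simp add: slot_def)

lemma slot_linear:
  assumes "a \<in> E"
  shows "slot I a f (\<lambda>i j. c * g i j + d * h i j)
    = conj_if (\<alpha> a = 0) c * slot I a f g + conj_if (\<alpha> a = 0) d * slot I a f h"
  by (simp add: slot_eq[OF assms] sum_distrib_left sum.distrib algebra_simps)

lemma hom_sum_scale: "cmod (hom_sum I (\<lambda>i j. c * f i j)) = cmod c ^ card E * cmod (hom_sum I f)"
proof -
  have "hom_sum I (\<lambda>i j. c * f i j) = (\<Prod>e\<in>E. conj_if (\<alpha> e = 0) c) * hom_sum I f"
    by (simp add: multi_hom_def sum_distrib_left prod.distrib)
  then show ?thesis by (simp add: norm_mult prod_norm[symmetric])
qed

text \<open>The product rule gives one term per edge, with \<open>g\<close> in its slot. As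
  \<open>s\<close> is real, the conjugations in the slots of colour 0 leave it unchanged.\<close>

lemma hom_sum_has_derivative:
  "((\<lambda>s::real. hom_sum I (\<lambda>i j. f i j + of_real s * g i j)) has_vector_derivative
     (\<Sum>a\<in>E. slot I a (\<lambda>i j. f i j + of_real s * g i j) g)) (at s)"
proof -
  let ?P = "PiE (A \<union> B) (\<lambda>_. I)"
  let ?x = "\<lambda>\<phi> e. conj_if (\<alpha> e = 0) (f (\<phi> (fst e)) (\<phi> (snd e)))"
  let ?y = "\<lambda>\<phi> e. conj_if (\<alpha> e = 0) (g (\<phi> (fst e)) (\<phi> (snd e)))"
  have "((\<lambda>s. \<Sum>\<phi>\<in>?P. \<Prod>e\<in>E. ?x \<phi> e + of_real s * ?y \<phi> e) has_derivative
    (\<lambda>t. \<Sum>\<phi>\<in>?P. \<Sum>a\<in>E. (of_real t * ?y \<phi> a) * (\<Prod>e\<in>E - {a}. ?x \<phi> e + of_real s * ?y \<phi> e))) (at s)"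
    by (intro has_derivative_sum has_derivative_prod) (auto intro!: derivative_eq_intros)
  moreover have "(\<lambda>t. \<Sum>\<phi>\<in>?P. \<Sum>a\<in>E. (of_real t * ?y \<phi> a) * (\<Prod>e\<in>E - {a}. ?x \<phi> e + of_real s * ?y \<phi> e))
    = (\<lambda>t. t *\<^sub>R (\<Sum>a\<in>E. slot I a (\<lambda>i j. f i j + of_real s * g i j) g))"
    by (subst sum.swap) (simp add: slot_eq scaleR_conv_of_real sum_distrib_left mult.assoc)
  ultimately show ?thesis
    by (simp add: has_vector_derivative_def multi_hom_def)
qed

definition tensor :: "nat \<Rightarrow> ('i \<Rightarrow> 'i \<Rightarrow> complex) \<Rightarrow> (nat \<Rightarrow> 'i) \<Rightarrow> (nat \<Rightarrow> 'i) \<Rightarrow> complex" where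
  "tensor k f p q = (\<Prod>j<k. f (p j) (q j))"

text \<open>A map of the vertices into the k-th power of \<open>I\<close> amounts to k independent
  maps into \<open>I\<close>, and the weight of a tensor power is the product of the weights of
  these maps.\<close>

lemma multi_hom_tensor:
  assumes "finite I"
  shows "multi_hom (PiE {..<k} (\<lambda>_. I)) (\<lambda>e. tensor k (F e)) = multi_hom I F ^ k"
proof -
  let ?V = "A \<union> B"
  let ?W = "\<lambda>\<phi>. \<Prod>e\<in>E. conj_if (\<alpha> e = 0) (F e (\<phi> (fst e)) (\<phi> (snd e)))"
  have "multi_hom I F ^ k = (\<Prod>j<k. \<Sum>\<phi>\<in>PiE ?V (\<lambda>_. I). ?W \<phi>)"
    by (simp add: multi_hom_def)
  also have "\<dots> = (\<Sum>\<Psi>\<in>PiE {..<k} (\<lambda>_. PiE ?V (\<lambda>_. I)). \<Prod>j<k. ?W (\<Psi> j))"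
    by (rule prod_sum_PiE) (auto intro: finite_maps assms)
  also have "\<dots> = (\<Sum>\<Phi>\<in>PiE ?V (\<lambda>_. PiE {..<k} (\<lambda>_. I)). \<Prod>j<k. \<Prod>e\<in>E.
      conj_if (\<alpha> e = 0) (F e (\<Phi> (fst e) j) (\<Phi> (snd e) j)))"
    using sum.reindex_bij_betw[OF bij_betw_PiE_swap[of "{..<k}" ?V I],
        of "\<lambda>\<Phi>. \<Prod>j<k. \<Prod>e\<in>E. conj_if (\<alpha> e = 0) (F e (\<Phi> (fst e) j) (\<Phi> (snd e) j))"]
    by (simp only: edge_ends restrict_apply' cong: prod.cong)
  also have "\<dots> = multi_hom (PiE {..<k} (\<lambda>_. I)) (\<lambda>e. tensor k (F e))"
    unfolding multi_hom_def tensor_def conj_if_prod by (subst prod.swap) simp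
  finally show ?thesis by simp
qed

end

section \<open>Support functionals\<close>

context norming_bigraph
begin

lemma hnorm_nonneg: "0 \<le> hnorm I f"
  by (simp add: hnorm_def)

lemma hnorm_pos: "0 < hnorm I f \<longleftrightarrow> hom_sum I f \<noteq> 0"
  by (simp add: hnorm_def)

lemma hnorm_power: "hnorm I f ^ card E = cmod (hom_sum I f)"
proof (cases "hom_sum I f = 0")
  case False
  then show ?thesis using card_E_pos by (simp add: hnorm_def powr_power)
qed (use card_E_pos in \<open>simp add: hnorm_def\<close>)

lemma hnorm_unique: "0 \<le> x \<Longrightarrow> x ^ card E = cmod (hom_sum I f) \<Longrightarrow> hnorm I f = x"
  using card_E_pos hnorm_power[of I f] hnorm_nonneg[of I f] by (metis power_eq_iff_eq_base)

lemma hnorm_scale: "hnorm I (\<lambda>i j. c * f i j) = cmod c * hnorm I f"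
  by (rule hnorm_unique) (simp_all add: hnorm_nonneg power_mult_distrib hnorm_power hom_sum_scale)

lemma hnorm_tensor:
  assumes "finite I"
  shows "hnorm (PiE {..<k} (\<lambda>_. I)) (tensor k f) = hnorm I f ^ k"
proof (rule hnorm_unique)
  have "(hnorm I f ^ k) ^ card E = (hnorm I f ^ card E) ^ k" by (simp add: mult.commute flip: power_mult)
  also have "\<dots> = cmod (hom_sum I f ^ k)" by (simp only: hnorm_power norm_power)
  also have "hom_sum I f ^ k = hom_sum (PiE {..<k} (\<lambda>_. I)) (tensor k f)"
    using multi_hom_tensor[OF assms, of k "\<lambda>_. f"] by simp
  finally show "(hnorm I f ^ k) ^ card E = cmod (hom_sum (PiE {..<k} (\<lambda>_. I)) (tensor k f))" .
qed (simp add: hnorm_nonneg)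

text \<open>For every edge \<open>a\<close> this is a complex linear functional of \<open>g\<close>; the conjugation undoes the
  antilinearity in the slots of colour 0.\<close>

definition functional :: "'i set \<Rightarrow> ('i \<Rightarrow> 'i \<Rightarrow> complex) \<Rightarrow> 'v \<times> 'v \<Rightarrow> ('i \<Rightarrow> 'i \<Rightarrow> complex) \<Rightarrow> complex" where
  "functional I f a g = conj_if (\<alpha> a = 0) (slot I a f g / hom_sum I f)"

lemma functional_linear:
  assumes "a \<in> E"
  shows "functional I f a (\<lambda>i j. c * g i j + d * h i j) = c * functional I f a g + d * functional I f a h"
  by (simp add: functional_def slot_linear[OF assms] add_divide_distrib)

lemma functional_scale: "a \<in> E \<Longrightarrow> functional I f a (\<lambda>i j. c * g i j) = c * functional I f a g"
  using functional_linear[of a I f c g 0 g] by simp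

lemma functional_self: "hom_sum I f \<noteq> 0 \<Longrightarrow> functional I f a f = 1"
  by (simp add: functional_def)

lemma functional_tensor:
  assumes "finite I"
  shows "functional (PiE {..<k} (\<lambda>_. I)) (tensor k f) a (tensor k g) = functional I f a g ^ k"
proof -
  have "slot (PiE {..<k} (\<lambda>_. I)) a (tensor k f) (tensor k g)
    = multi_hom (PiE {..<k} (\<lambda>_. I)) (\<lambda>e. tensor k (if e = a then g else f))"
    unfolding slot_def by (rule arg_cong[where f = "multi_hom _"]) auto
  then show ?thesis
    using multi_hom_tensor[OF assms, of k "\<lambda>e. if e = a then g else f"]
      multi_hom_tensor[OF assms, of k "\<lambda>_. f"]
    by (simp add: functional_def slot_def power_divide)
qed

text \<open>Dividing by the value at \<open>f\<close> gives \<open>Q 0 = 1\<close>, so that to first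
  order the modulus of \<open>Q\<close> changes like its real part. Real parts do not see the
  conjugation that \<open>functional\<close> adds in the slots of colour 0.\<close>

lemma normalized_derivative:
  fixes f g :: "'i \<Rightarrow> 'i \<Rightarrow> complex"
  assumes "hom_sum I f \<noteq> 0"
  defines "Q \<equiv> \<lambda>s::real. hom_sum I (\<lambda>i j. f i j + of_real s * g i j) / hom_sum I f"
  obtains D where "((\<lambda>s. Re (Q s)) has_real_derivative Re D) (at 0)"
    "((\<lambda>s. Im (Q s)) has_real_derivative Im D) (at 0)"
    "Re D = Re (\<Sum>a\<in>E. functional I f a g)"
proof
  let ?D = "(\<Sum>a\<in>E. slot I a f g) / hom_sum I f"
  have "(Q has_vector_derivative ?D) (at 0)"
    using has_vector_derivative_mult_left[OF hom_sum_has_derivative[of I f g 0], of "inverse (hom_sum I f)"]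
    by (simp add: Q_def divide_inverse)
  then show "((\<lambda>s. Re (Q s)) has_real_derivative Re ?D) (at 0)"
    "((\<lambda>s. Im (Q s)) has_real_derivative Im ?D) (at 0)"
    by (auto simp: has_real_derivative_iff_has_vector_derivative
        intro: bounded_linear.has_vector_derivative[OF bounded_linear_Re]
          bounded_linear.has_vector_derivative[OF bounded_linear_Im])
  show "Re ?D = Re (\<Sum>a\<in>E. functional I f a g)"
    by (simp only: functional_def sum_divide_distrib Re_sum Re_conj_if)
qed

text \<open>For \<open>s \<ge> 0\<close> the triangle inequality bounds \<open>Re (Q s)\<close> by
  \<open>(1 + s * N) ^ card E\<close>, where \<open>N\<close> is the quotient of the norms. Both
  sides equal 1 at \<open>s = 0\<close>, so their derivatives there are ordered in the same
  way.\<close>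

lemma sum_functional_le:
  assumes I: "finite I" "I \<noteq> {}" and nz: "hom_sum I f \<noteq> 0"
  shows "Re (\<Sum>a\<in>E. functional I f a g) \<le> real (card E) * (hnorm I g / hnorm I f)"
proof (rule ccontr)
  define N where "N = hnorm I g / hnorm I f"
  define Q where "Q = (\<lambda>s::real. hom_sum I (\<lambda>i j. f i j + of_real s * g i j) / hom_sum I f)"
  obtain D where D: "((\<lambda>s. Re (Q s)) has_real_derivative Re D) (at 0)"
    "Re D = Re (\<Sum>a\<in>E. functional I f a g)"
    unfolding Q_def by (rule normalized_derivative[OF nz, of g]) blast
  have pos: "hnorm I f > 0" using nz by (simp add: hnorm_pos)
  assume "\<not> ?thesis"
  then have neg: "real (card E) * N - Re D < 0" by (simp add: D N_def)
  have "((\<lambda>s. (1 + s * N) ^ card E - Re (Q s)) has_real_derivative (real (card E) * N - Re D)) (at 0)"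
    by (rule derivative_eq_intros D refl | simp)+
  from DERIV_neg_dec_right[OF this neg] obtain d where d: "d > 0"
    "\<And>h. 0 < h \<Longrightarrow> h < d \<Longrightarrow> (1 + h * N) ^ card E - Re (Q h) < 1 - Re (Q 0)"
    by auto
  define s where "s = d / 2"
  have s: "0 < s" "s < d" using d(1) by (auto simp: s_def)
  have "hnorm I (\<lambda>i j. f i j + of_real s * g i j) \<le> hnorm I f + hnorm I (\<lambda>i j. of_real s * g i j)"
    by (rule hnorm_triangle[OF I])
  also have "\<dots> = (1 + s * N) * hnorm I f"
    using pos s by (simp add: hnorm_scale N_def field_simps)
  finally have "hnorm I (\<lambda>i j. f i j + of_real s * g i j) ^ card E \<le> ((1 + s * N) * hnorm I f) ^ card E"
    by (intro power_mono hnorm_nonneg)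
  then have "cmod (hom_sum I (\<lambda>i j. f i j + of_real s * g i j)) \<le> (1 + s * N) ^ card E * cmod (hom_sum I f)"
    unfolding power_mult_distrib hnorm_power .
  then have "cmod (Q s) \<le> (1 + s * N) ^ card E"
    using nz by (simp add: Q_def hnorm_power norm_divide power_mult_distrib field_simps)
  then have "Re (Q s) \<le> (1 + s * N) ^ card E" using complex_Re_le_cmod[of "Q s"] by simp
  moreover have "Q 0 = 1" using nz by (simp add: Q_def)
  ultimately show False using d(2)[OF s] by simp
qed

text \<open>A weak form of Hoelder's inequality. The power sums of the functionals are controlled by passing
  to tensor powers, and this bounds the functionals one by one.\<close>

lemma functional_le:
  assumes I: "finite I" "I \<noteq> {}" and nz: "hom_sum I f \<noteq> 0" and a: "a \<in> E"
  shows "cmod (functional I f a g) \<le> hnorm I g / hnorm I f"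
proof (rule norm_le_of_power_sums_le[OF finite_E a])
  show "0 \<le> hnorm I g / hnorm I f" by (simp add: hnorm_nonneg)
  fix k :: nat
  let ?K = "PiE {..<k} (\<lambda>_. I)"
  have "finite ?K" "?K \<noteq> {}" using I by (auto intro: finite_PiE simp: PiE_eq_empty_iff)
  moreover have "hom_sum ?K (tensor k f) \<noteq> 0"
    using multi_hom_tensor[OF I(1), of k "\<lambda>_. f"] nz by simp
  \<comment> \<open>The graph stays the same for every tensor power, so the constant
    \<open>card E\<close> does not grow with \<open>k\<close>.\<close>
  ultimately have "Re (\<Sum>b\<in>E. functional ?K (tensor k f) b (tensor k g))
    \<le> real (card E) * (hnorm ?K (tensor k g) / hnorm ?K (tensor k f))"
    by (rule sum_functional_le)
  then show "Re (\<Sum>b\<in>E. functional I f b g ^ k) \<le> real (card E) * (hnorm I g / hnorm I f) ^ k"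
    by (simp add: functional_tensor hnorm_tensor I power_divide)
qed

text \<open>The support functional of a differentiable norm is unique.\<close>

lemma Re_functional_eq:
  assumes I: "finite I" "I \<noteq> {}" and nz: "hom_sum I f \<noteq> 0" and a: "a \<in> E"
  shows "real (card E) * Re (functional I f a g) = Re (\<Sum>b\<in>E. functional I f b g)"
proof -
  define \<mu> where "\<mu> = functional I f a g"
  define Q where "Q = (\<lambda>s::real. hom_sum I (\<lambda>i j. f i j + of_real s * g i j) / hom_sum I f)"
  obtain D where D: "((\<lambda>s. Re (Q s)) has_real_derivative Re D) (at 0)"
    "((\<lambda>s. Im (Q s)) has_real_derivative Im D) (at 0)"
    "Re D = Re (\<Sum>a\<in>E. functional I f a g)"
    unfolding Q_def by (rule normalized_derivative[OF nz, of g]) blast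
  \<comment> \<open>This is the squared modulus of \<open>Q s\<close> minus the squared modulus of
    \<open>(1 + s * \<mu>) ^ card E\<close>; squaring makes both terms differentiable. The bound on
    the functional at \<open>f + s g\<close> makes \<open>h\<close> nonnegative for \<open>s\<close>
    of either sign, and \<open>h 0 = 0\<close>, so its derivative at 0 vanishes.\<close>
  define h where "h = (\<lambda>s. (Re (Q s))\<^sup>2 + (Im (Q s))\<^sup>2 - ((1 + s * Re \<mu>)\<^sup>2 + (s * Im \<mu>)\<^sup>2) ^ card E)"
  have Q0: "Q 0 = 1" using nz by (simp add: Q_def)
  have "(h has_real_derivative (2 * Re D - 2 * (real (card E) * Re \<mu>))) (at 0)"
    unfolding h_def by (rule derivative_eq_intros D refl | simp add: Q0)+
  moreover have "h 0 \<le> h s" for s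
  proof -
    have "functional I f a (\<lambda>i j. 1 * f i j + of_real s * g i j) = 1 + of_real s * \<mu>"
      unfolding functional_linear[OF a] functional_self[OF nz] \<mu>_def by simp
    then have "cmod (1 + of_real s * \<mu>) \<le> hnorm I (\<lambda>i j. f i j + of_real s * g i j) / hnorm I f"
      using functional_le[OF I nz a, of "\<lambda>i j. 1 * f i j + of_real s * g i j"] by simp
    then have "cmod (1 + of_real s * \<mu>) ^ card E \<le> (hnorm I (\<lambda>i j. f i j + of_real s * g i j) / hnorm I f) ^ card E"
      by (intro power_mono) auto
    then have "cmod (1 + of_real s * \<mu>) ^ card E \<le> cmod (Q s)"
      by (simp add: power_divide hnorm_power Q_def norm_divide)
    then have "(cmod (1 + of_real s * \<mu>) ^ card E)\<^sup>2 \<le> (cmod (Q s))\<^sup>2" by (intro power_mono) auto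
    moreover have "(cmod (1 + of_real s * \<mu>) ^ card E)\<^sup>2 = ((cmod (1 + of_real s * \<mu>))\<^sup>2) ^ card E"
      by (simp add: mult.commute flip: power_mult)
    ultimately show ?thesis by (simp add: h_def Q0 cmod_power2)
  qed
  ultimately have "2 * Re D - 2 * (real (card E) * Re \<mu>) = 0"
    by (intro DERIV_local_min[of h _ 0 1]) auto
  then show ?thesis using D(3) by (simp add: \<mu>_def)
qed

text \<open>The real parts agree for every direction. Since the functionals are complex linear, the
  direction \<open>\<i> * g\<close> turns this into agreement of the imaginary parts.\<close>

lemma functional_eq:
  assumes I: "finite I" "I \<noteq> {}" and nz: "hom_sum I f \<noteq> 0" and a: "a \<in> E" and b: "b \<in> E"
  shows "functional I f a g = functional I f b g"
proof -
  have re: "Re (functional I f a h) = Re (functional I f b h)" for h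
    using Re_functional_eq[OF I nz a, of h] Re_functional_eq[OF I nz b, of h] card_E_pos
    by (metis mult_cancel_left of_nat_0_less_iff order_less_irrefl)
  have "Re (functional I f a g) = Re (functional I f b g)" by (rule re)
  moreover have "Im (functional I f a g) = Im (functional I f b g)"
    using re[of "\<lambda>i j. \<i> * g i j"] by (simp add: functional_scale a b)
  ultimately show ?thesis by (rule complex_eqI)
qed

end

section \<open>Balance and realness\<close>

context norming_bigraph
begin

section \<open>Rank-one functions and balancedness\<close>

lemma prod_conj_if_card:
  assumes "finite S"
  shows "(\<Prod>e\<in>S. conj_if (\<alpha> e = 0) z) = z ^ card {e\<in>S. \<alpha> e \<noteq> 0} * cnj z ^ card {e\<in>S. \<alpha> e = 0}"
proof -
  have "(\<Prod>e\<in>S. conj_if (\<alpha> e = 0) z) = (\<Prod>e\<in>S. if \<alpha> e = 0 then cnj z else z)"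
    by (simp add: conj_if_def)
  also have "\<dots> = cnj z ^ card (S \<inter> {e. \<alpha> e = 0}) * z ^ card (S \<inter> - {e. \<alpha> e = 0})"
    by (simp add: prod.If_cases[OF assms])
  finally show ?thesis by (simp add: Int_def Compl_eq mult.commute)
qed

text \<open>The weight of each edge splits into weights at its two ends, so the vertices range over
  \<open>I\<close> independently and a single vertex can make the whole sum vanish.\<close>

lemma hom_sum_rank_one:
  assumes "finite I"
  shows "hom_sum I (\<lambda>i j. h i * k j) = (\<Prod>v\<in>A \<union> B. \<Sum>i\<in>I.
    (\<Prod>e\<in>{e\<in>E. fst e = v}. conj_if (\<alpha> e = 0) (h i)) * (\<Prod>e\<in>{e\<in>E. snd e = v}. conj_if (\<alpha> e = 0) (k i)))"
    (is "_ = (\<Prod>v\<in>_. \<Sum>i\<in>_. ?w v i)")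
proof -
  have "(\<Prod>e\<in>E. conj_if (\<alpha> e = 0) (h (\<phi> (fst e)) * k (\<phi> (snd e)))) = (\<Prod>v\<in>A \<union> B. ?w v (\<phi> v))" for \<phi>
  proof -
    have "(\<Prod>e\<in>E. conj_if (\<alpha> e = 0) (h (\<phi> (fst e)))) =
        (\<Prod>v\<in>A \<union> B. \<Prod>e\<in>{e\<in>E. fst e = v}. conj_if (\<alpha> e = 0) (h (\<phi> (fst e))))"
      by (rule prod.group[OF finite_E finite_AB, symmetric]) (use edge_ends in blast)
    moreover have "(\<Prod>e\<in>E. conj_if (\<alpha> e = 0) (k (\<phi> (snd e)))) =
        (\<Prod>v\<in>A \<union> B. \<Prod>e\<in>{e\<in>E. snd e = v}. conj_if (\<alpha> e = 0) (k (\<phi> (snd e))))"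
      by (rule prod.group[OF finite_E finite_AB, symmetric]) (use edge_ends in blast)
    ultimately show ?thesis by (simp add: prod.distrib)
  qed
  then show ?thesis
    unfolding multi_hom_def using prod_sum_PiE[OF finite_AB, of "\<lambda>_. I" ?w] assms by simp
qed

text \<open>For unimodular \<open>z\<close> the product has argument \<open>p - q\<close> times that
  of \<open>z\<close>; the angle is chosen to make this pi, whichever of \<open>p\<close> and
  \<open>q\<close> is larger.\<close>

lemma power_cis_neg_one:
  assumes "p \<noteq> q"
  defines "z \<equiv> cis (pi / (real p - real q))"
  shows "z ^ p * cnj z ^ q = -1"
proof -
  define t where "t = pi / (real p - real q)"
  have "z ^ p * cnj z ^ q = cis (real p * t + real q * - t)"
    unfolding z_def t_def[symmetric] by (simp only: cis_cnj Complex.DeMoivre cis_mult)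
  also have "real p * t + real q * - t = (real p - real q) * t" by (simp add: algebra_simps)
  also have "\<dots> = pi" using assms(1) by (simp add: t_def)
  finally show ?thesis by simp
qed

text \<open>If a vertex sees different numbers of edges of the two colours, then a function of the
  corresponding coordinate with two unimodular values has density 0.\<close>

lemma balanced_fst: "card {e\<in>E. fst e = v \<and> \<alpha> e = 0} = card {e\<in>E. fst e = v \<and> \<alpha> e \<noteq> 0}"
  and balanced_snd: "card {e\<in>E. snd e = v \<and> \<alpha> e = 0} = card {e\<in>E. snd e = v \<and> \<alpha> e \<noteq> 0}"
proof -
  let ?h = "\<lambda>z b. if b then z else 1 :: complex"
  show "card {e\<in>E. fst e = v \<and> \<alpha> e = 0} = card {e\<in>E. fst e = v \<and> \<alpha> e \<noteq> 0}"
  proof (rule ccontr)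
    assume ne: "\<not> ?thesis"
    then have v: "v \<in> A \<union> B" using edge_ends(1) by (metis (mono_tags, lifting) Collect_empty_eq)
    define z where "z = cis (pi / (real (card {e\<in>E. fst e = v \<and> \<alpha> e \<noteq> 0}) - real (card {e\<in>E. fst e = v \<and> \<alpha> e = 0})))"
    have "(\<Prod>e\<in>{e\<in>E. fst e = v}. conj_if (\<alpha> e = 0) z) = -1"
      using power_cis_neg_one[of "card {e\<in>E. fst e = v \<and> \<alpha> e \<noteq> 0}" "card {e\<in>E. fst e = v \<and> \<alpha> e = 0}"] ne finite_E
      by (simp add: prod_conj_if_card z_def conj_assoc)
    \<comment> \<open>The factor of the vertex \<open>v\<close> adds -1, coming from the index
      \<open>True\<close>, to 1, coming from the index \<open>False\<close>.\<close>
    then have "hom_sum UNIV (\<lambda>i j. ?h z i * 1) = 0"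
      unfolding hom_sum_rank_one[OF finite]
      by (intro prod_zero[OF finite_AB] bexI[OF _ v]) (simp add: UNIV_bool)
    moreover have "hom_sum UNIV (\<lambda>i j. ?h z i * 1) \<noteq> 0"
      by (rule hom_sum_nonzero[of _ False False]) auto
    ultimately show False by simp
  qed
  show "card {e\<in>E. snd e = v \<and> \<alpha> e = 0} = card {e\<in>E. snd e = v \<and> \<alpha> e \<noteq> 0}"
  proof (rule ccontr)
    assume ne: "\<not> ?thesis"
    then have v: "v \<in> A \<union> B" using edge_ends(2) by (metis (mono_tags, lifting) Collect_empty_eq)
    define z where "z = cis (pi / (real (card {e\<in>E. snd e = v \<and> \<alpha> e \<noteq> 0}) - real (card {e\<in>E. snd e = v \<and> \<alpha> e = 0})))"
    have "(\<Prod>e\<in>{e\<in>E. snd e = v}. conj_if (\<alpha> e = 0) z) = -1"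
      using power_cis_neg_one[of "card {e\<in>E. snd e = v \<and> \<alpha> e \<noteq> 0}" "card {e\<in>E. snd e = v \<and> \<alpha> e = 0}"] ne finite_E
      by (simp add: prod_conj_if_card z_def conj_assoc)
    then have "hom_sum UNIV (\<lambda>i j. 1 * ?h z j) = 0"
      unfolding hom_sum_rank_one[OF finite]
      by (intro prod_zero[OF finite_AB] bexI[OF _ v]) (simp add: UNIV_bool)
    moreover have "hom_sum UNIV (\<lambda>i j. 1 * ?h z j) \<noteq> 0"
      by (rule hom_sum_nonzero[of _ False False]) auto
    ultimately show False by simp
  qed
qed

lemma balanced: "balanced A B E \<alpha>"
  unfolding balanced_def
proof
  fix w assume w: "w \<in> A \<union> B"
  have one: "\<alpha> e = 1 \<longleftrightarrow> \<alpha> e \<noteq> 0" if "e \<in> E" for e using col_cases[OF that] by auto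
  consider "w \<in> A" | "w \<in> B" using w by blast
  then show "card {e \<in> E. (w = fst e \<or> w = snd e) \<and> \<alpha> e = 0} = card {e \<in> E. (w = fst e \<or> w = snd e) \<and> \<alpha> e = 1}"
  proof cases
    case 1
    then have "w = fst e \<or> w = snd e \<longleftrightarrow> fst e = w" if "e \<in> E" for e
      using subsetD[OF E_sub that] AB_disj by (auto simp: mem_Times_iff)
    then have "{e\<in>E. (w = fst e \<or> w = snd e) \<and> \<alpha> e = 0} = {e\<in>E. fst e = w \<and> \<alpha> e = 0}"
      "{e\<in>E. (w = fst e \<or> w = snd e) \<and> \<alpha> e = 1} = {e\<in>E. fst e = w \<and> \<alpha> e \<noteq> 0}"
      using one by blast+
    then show ?thesis using balanced_fst[of w] by (simp only:)
  next
    case 2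
    then have "w = fst e \<or> w = snd e \<longleftrightarrow> snd e = w" if "e \<in> E" for e
      using subsetD[OF E_sub that] AB_disj by (auto simp: mem_Times_iff)
    then have "{e\<in>E. (w = fst e \<or> w = snd e) \<and> \<alpha> e = 0} = {e\<in>E. snd e = w \<and> \<alpha> e = 0}"
      "{e\<in>E. (w = fst e \<or> w = snd e) \<and> \<alpha> e = 1} = {e\<in>E. snd e = w \<and> \<alpha> e \<noteq> 0}"
      using one by blast+
    then show ?thesis using balanced_snd[of w] by (simp only:)
  qed
qed

section \<open>Realness of the density\<close>

lemma card_colours_eq: "card {e\<in>E. \<alpha> e = 0} = card {e\<in>E. \<alpha> e \<noteq> 0}"
proof -
  have group: "card {e\<in>E. P e} = (\<Sum>v\<in>A \<union> B. card {e\<in>E. fst e = v \<and> P e})" for P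
  proof -
    have "card {e\<in>E. P e} = (\<Sum>e\<in>{e\<in>E. P e}. 1)" by simp
    also have "\<dots> = (\<Sum>v\<in>A \<union> B. \<Sum>e\<in>{e\<in>{e\<in>E. P e}. fst e = v}. 1)"
      by (rule sum.group[symmetric]) (use finite_E finite_AB edge_ends in auto)
    also have "\<dots> = (\<Sum>v\<in>A \<union> B. card {e\<in>E. fst e = v \<and> P e})"
      unfolding card_eq_sum by (intro sum.cong refl) auto
    finally show ?thesis .
  qed
  show ?thesis unfolding group[of "\<lambda>e. \<alpha> e = 0"] group[of "\<lambda>e. \<alpha> e \<noteq> 0"]
    by (simp only: balanced_fst)
qed

text \<open>The logarithmic derivative of \<open>hom_sum I f\<close> in direction \<open>g\<close> is a sum of as many
  copies of the common value of the functionals as of its conjugate, hence real.\<close>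

lemma hom_sum_derivative_real:
  assumes I: "finite I" "I \<noteq> {}" and nz: "hom_sum I f \<noteq> 0"
  obtains k :: real where "(\<Sum>a\<in>E. slot I a f g) = of_real k * hom_sum I f"
proof -
  obtain a where a: "a \<in> E" using E_nonempty by blast
  define \<mu> where "\<mu> = functional I f a g"
  have "slot I b f g = conj_if (\<alpha> b = 0) \<mu> * hom_sum I f" if "b \<in> E" for b
    using functional_eq[OF I nz a that, of g] nz by (simp add: \<mu>_def functional_def conj_if_def)
  then have "(\<Sum>a\<in>E. slot I a f g) = (\<Sum>a\<in>E. conj_if (\<alpha> a = 0) \<mu>) * hom_sum I f"
    by (simp add: sum_distrib_right)
  also have "(\<Sum>a\<in>E. conj_if (\<alpha> a = 0) \<mu>) =
      of_nat (card {e\<in>E. \<alpha> e = 0}) * cnj \<mu> + of_nat (card {e\<in>E. \<alpha> e \<noteq> 0}) * \<mu>"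
    by (simp add: conj_if_def sum.If_cases[OF finite_E] Int_def Compl_eq)
  also have "\<dots> = of_real (card {e\<in>E. \<alpha> e = 0} * (2 * Re \<mu>))"
    by (simp add: card_colours_eq complex_eq_iff)
  finally show ?thesis by (rule that)
qed

text \<open>Along the segment from the constant 1 to \<open>f\<close> the sum never vanishes unless
  \<open>f\<close> is a real constant on \<open>I\<close>, a case settled directly. Its logarithmic
  derivative is real by \<open>hom_sum_derivative_real\<close>, so its argument modulo pi stays that
  of the real starting value.\<close>

lemma hom_sum_real:
  assumes I: "finite I" "I \<noteq> {}"
  shows "Im (hom_sum I f) = 0"
proof (cases "\<exists>r::real. \<forall>i\<in>I. \<forall>j\<in>I. f i j = of_real r")
  case True
  then obtain r :: real where "\<And>i j. i \<in> I \<Longrightarrow> j \<in> I \<Longrightarrow> f i j = of_real r" by blast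
  then have "hom_sum I f = hom_sum I (\<lambda>_ _. of_real r)" by (intro multi_hom_cong) auto
  also have "\<dots> = of_real (\<Sum>\<phi>\<in>PiE (A \<union> B) (\<lambda>_. I). r ^ card E)" by (simp add: multi_hom_def)
  finally show ?thesis by (simp only: Im_complex_of_real)
next
  case False
  define P where "P = (\<lambda>s::real. hom_sum I (\<lambda>i j. 1 + of_real s * (f i j - 1)))"
  have nz: "P s \<noteq> 0" for s
  proof -
    have "\<exists>i\<in>I. \<exists>j\<in>I. 1 + of_real s * (f i j - 1) \<noteq> 0"
    proof (rule ccontr)
      assume "\<not> ?thesis"
      then have z: "1 + of_real s * (f i j - 1) = 0" if "i \<in> I" "j \<in> I" for i j using that by blast
      obtain i where "i \<in> I" using I(2) by blast
      then have "s \<noteq> 0" using z[of i i] by auto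
      then have "f i j = of_real (1 - 1 / s)" if "i \<in> I" "j \<in> I" for i j
        using z[OF that] by (simp add: field_simps add_eq_0_iff)
      then show False using False by blast
    qed
    then obtain i j where "i \<in> I" "j \<in> I" "1 + of_real s * (f i j - 1) \<noteq> 0" by blast
    then show ?thesis unfolding P_def by (rule hom_sum_nonzero[OF I(1)])
  qed
  have ne: "(Re (P s))\<^sup>2 + (Im (P s))\<^sup>2 \<noteq> 0" for s
    using nz[of s] by (simp add: sum_power2_eq_zero_iff complex_eq_iff)
  \<comment> \<open>The squared sine of the argument of \<open>P s\<close>, which avoids choosing a
    branch of the logarithm. Both squares have logarithmic rate \<open>2 * k\<close>, so the
    quotient is constant.\<close>
  define h where "h = (\<lambda>s. (Im (P s))\<^sup>2 / ((Re (P s))\<^sup>2 + (Im (P s))\<^sup>2))"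
  have "(h has_real_derivative 0) (at s)" for s
  proof -
    obtain k :: real where k: "(\<Sum>a\<in>E. slot I a (\<lambda>i j. 1 + of_real s * (f i j - 1)) (\<lambda>i j. f i j - 1)) = of_real k * P s"
      unfolding P_def by (rule hom_sum_derivative_real[OF I nz[of s, unfolded P_def], of "\<lambda>i j. f i j - 1"])
    have "(P has_vector_derivative (of_real k * P s)) (at s)"
      using hom_sum_has_derivative[of I "\<lambda>_ _. 1" "\<lambda>i j. f i j - 1" s] unfolding k P_def[symmetric] .
    then have "((\<lambda>s. Re (P s)) has_real_derivative Re (of_real k * P s)) (at s)"
      "((\<lambda>s. Im (P s)) has_real_derivative Im (of_real k * P s)) (at s)"
      unfolding has_real_derivative_iff_has_vector_derivative
      by (rule bounded_linear.has_vector_derivative[OF bounded_linear_Re],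
          rule bounded_linear.has_vector_derivative[OF bounded_linear_Im])
    from this[THEN DERIV_power, of 2]
    have der: "((\<lambda>s. (Re (P s))\<^sup>2) has_real_derivative 2 * k * (Re (P s))\<^sup>2) (at s)"
      "((\<lambda>s. (Im (P s))\<^sup>2) has_real_derivative 2 * k * (Im (P s))\<^sup>2) (at s)"
      by (simp_all add: power2_eq_square mult_ac)
    show ?thesis unfolding h_def
      by (rule DERIV_cong[OF DERIV_divide[OF der(2) DERIV_add[OF der] ne]]) (simp add: algebra_simps)
  qed
  then have "h 1 = h 0" by (intro DERIV_isconst_all) blast
  moreover have "Im (P 0) = 0"
    by (simp add: P_def multi_hom_def)
  ultimately have "Im (P 1) = 0"
    using ne[of 1] by (simp only: h_def power_zero_numeral div_0 divide_eq_0_iff power_eq_0_iff) simp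
  then show ?thesis by (simp add: P_def)
qed

text \<open>In \<open>functional_eq\<close> both sides carry the factor
  \<open>1 / hom_sum I f\<close> under a conjugation that depends on the edge. As this sum is real,
  the factor cancels.\<close>

lemma slot_eq_slot:
  assumes I: "finite I" "I \<noteq> {}" and nz: "hom_sum I f \<noteq> 0" and a: "a \<in> E" and b: "b \<in> E"
  shows "conj_if (\<alpha> a = 0) (slot I a f g) = conj_if (\<alpha> b = 0) (slot I b f g)"
proof -
  have "conj_if c (hom_sum I f) = hom_sum I f" for c
    using hom_sum_real[OF I, of f] by (simp add: conj_if_def complex_eq_iff)
  then show ?thesis using functional_eq[OF I nz a b, of g] nz by (simp add: functional_def)
qed

end

section \<open>Extracting automorphisms\<close>

definition cube_root :: complex where
  "cube_root = cis (2 * pi / 3)"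

lemma cube_root_simps:
  "cube_root * cnj cube_root = 1" "cnj cube_root = cube_root\<^sup>2" "1 + cube_root + cube_root\<^sup>2 = 0"
proof -
  have c: "cube_root = Complex (- 1 / 2) (sqrt 3 / 2)"
    by (simp add: cube_root_def complex_eq_iff cos_120 sin_120)
  show "cube_root * cnj cube_root = 1" "cnj cube_root = cube_root\<^sup>2" "1 + cube_root + cube_root\<^sup>2 = 0"
    by (simp_all add: c complex_eq_iff power2_eq_square)
qed

text \<open>Orthogonality of the characters of the group of order 3. Signs would not do: conjugation
  fixes them, whereas it exchanges the two nontrivial cube roots and so detects colours.\<close>

lemma sum_cube_roots: "(\<Sum>j<3. conj_if b (cnj (cube_root ^ j))) = 0"
  "(\<Sum>j<3. conj_if b (cnj (cube_root ^ j)) * conj_if b' (cube_root ^ j)) = (if b = b' then 3 else 0)"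
proof -
  define u v where "u = cube_root" and "v = cnj cube_root"
  have uu: "u * u = v" and vu: "v * u = 1" and uv: "u * v = 1" and sum: "1 + u + v = 0"
    using cube_root_simps by (simp_all add: u_def v_def power2_eq_square mult.commute)
  have vv: "v * v = u" using uu vu by (metis mult.assoc mult_1_right)
  have sum3: "(\<Sum>j<3. f j) = f 0 + f 1 + f 2" for f :: "nat \<Rightarrow> complex"
    by (simp add: eval_nat_numeral)
  have sum': "1 + v + u = 0" using sum by (simp add: add.commute add.left_commute)
  have cnju: "cnj u = v" by (simp add: u_def v_def)
  note simps = sum3 conj_if_def power2_eq_square u_def[symmetric] cnju uu vu uv vv sum sum'
  have cnj: "cnj v = u" by (simp add: u_def v_def)
  show "(\<Sum>j<3. conj_if b (cnj (cube_root ^ j))) = 0"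
    by (cases b) (simp_all add: simps cnj)
  show "(\<Sum>j<3. conj_if b (cnj (cube_root ^ j)) * conj_if b' (cube_root ^ j)) = (if b = b' then 3 else 0)"
    by (cases b; cases b') (simp_all add: simps cnj)
qed

context coloured_bigraph
begin

text \<open>Colours are only compared with those of \<open>c\<close> and \<open>a\<close>: this treats the
  colour-preserving and the colour-reversing maps uniformly.\<close>

definition edge_bijections :: "'v \<times> 'v \<Rightarrow> 'v \<times> 'v \<Rightarrow> ('v \<Rightarrow> 'v) set" where
  "edge_bijections c a = {\<phi> \<in> PiE (A \<union> B) (\<lambda>_. A \<union> B). map_prod \<phi> \<phi> c = a \<and>
     bij_betw (map_prod \<phi> \<phi>) (E - {c}) (E - {a}) \<and>
     (\<forall>e\<in>E. (\<alpha> e = \<alpha> c) = (\<alpha> (map_prod \<phi> \<phi> e) = \<alpha> a))}"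

text \<open>The sum over \<open>\<zeta>\<close> factorises over the edges other than
  \<open>a\<close>, and the factor of an edge depends only on its fibre under \<open>\<phi>\<close>.
  An empty fibre gives 0. If no fibre is empty, counting makes every fibre a single edge, whose
  factor is 3 when the colours are compatible and 0 otherwise.\<close>

lemma sum_colourings:
  assumes a: "a \<in> E" and c: "c \<in> E" and \<phi>: "\<phi> \<in> PiE (A \<union> B) (\<lambda>_. A \<union> B)" and \<phi>c: "map_prod \<phi> \<phi> c = a"
  defines "f \<equiv> \<lambda>\<zeta> e. if e = a then 1 else if e \<in> E then cube_root ^ \<zeta> e else 0"
  shows "(\<Sum>\<zeta>\<in>PiE (E - {a}) (\<lambda>_. {..<3::nat}).
      (\<Prod>e\<in>E - {a}. conj_if ((\<alpha> e = 0) \<noteq> (\<alpha> a = 0)) (cnj (cube_root ^ \<zeta> e))) *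
      (\<Prod>e\<in>E - {c}. conj_if ((\<alpha> e = 0) \<noteq> (\<alpha> c = 0)) (f \<zeta> (map_prod \<phi> \<phi> e))))
    = (if \<phi> \<in> edge_bijections c a then 3 ^ (card E - 1) else 0)"
proof -
  let ?m = "map_prod \<phi> \<phi>"
  let ?k = "\<lambda>c e. conj_if ((\<alpha> e = 0) \<noteq> (\<alpha> c = 0))"
  let ?fib = "\<lambda>e'. {e\<in>E - {c}. ?m e = e'}"
  have fin: "finite (E - {c})" "finite (E - {a})" using finite_E by auto
  show ?thesis
  proof (cases "?m ` (E - {c}) \<subseteq> E")
    case False
    then obtain e where e: "e \<in> E - {c}" "?m e \<notin> E" unfolding image_subset_iff by blast
    have "(\<Prod>e\<in>E - {c}. ?k c e (f \<zeta> (?m e))) = 0" for \<zeta>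
      by (rule prod_zero[OF fin(1)], rule bexI[OF _ e(1)]) (use e a in \<open>auto simp: f_def\<close>)
    moreover have "\<phi> \<notin> edge_bijections c a"
      using e by (auto simp: edge_bijections_def bij_betw_def)
    ultimately show ?thesis by simp
  next
    case sub: True
    define G where "G = (\<lambda>e' j. ?k a e' (cnj (cube_root ^ j)) * (\<Prod>e\<in>?fib e'. ?k c e (cube_root ^ j)))"
    have "(\<Prod>e\<in>E - {c}. ?k c e (f \<zeta> (?m e))) = (\<Prod>e'\<in>E - {a}. \<Prod>e\<in>?fib e'. ?k c e (cube_root ^ \<zeta> e'))" for \<zeta>
    proof -
      have "(\<Prod>e\<in>E - {c}. ?k c e (f \<zeta> (?m e))) = (\<Prod>e'\<in>E. \<Prod>e\<in>?fib e'. ?k c e (f \<zeta> (?m e)))"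
        by (rule prod.group[OF fin(1) finite_E sub, symmetric])
      also have "\<dots> = (\<Prod>e\<in>?fib a. ?k c e (f \<zeta> (?m e))) * (\<Prod>e'\<in>E - {a}. \<Prod>e\<in>?fib e'. ?k c e (f \<zeta> (?m e)))"
        by (rule prod.remove[OF finite_E a])
      \<comment> \<open>Edges other than \<open>c\<close> may also be mapped to \<open>a\<close> and
        then have weight 1. Such maps are excluded by counting, since they leave some other fibre
        empty.\<close>
      also have "(\<Prod>e\<in>?fib a. ?k c e (f \<zeta> (?m e))) = 1"
        by (rule prod.neutral) (simp add: f_def)
      also have "(\<Prod>e'\<in>E - {a}. \<Prod>e\<in>?fib e'. ?k c e (f \<zeta> (?m e))) = (\<Prod>e'\<in>E - {a}. \<Prod>e\<in>?fib e'. ?k c e (cube_root ^ \<zeta> e'))"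
        by (intro prod.cong refl) (simp add: f_def)
      finally show ?thesis by simp
    qed
    then have "(\<Sum>\<zeta>\<in>PiE (E - {a}) (\<lambda>_. {..<3::nat}). (\<Prod>e\<in>E - {a}. ?k a e (cnj (cube_root ^ \<zeta> e))) *
        (\<Prod>e\<in>E - {c}. ?k c e (f \<zeta> (?m e)))) = (\<Sum>\<zeta>\<in>PiE (E - {a}) (\<lambda>_. {..<3}). \<Prod>e'\<in>E - {a}. G e' (\<zeta> e'))"
      by (simp only: G_def prod.distrib)
    also have "\<dots> = (\<Prod>e'\<in>E - {a}. \<Sum>j<3. G e' j)"
      by (rule prod_sum_PiE[symmetric]) (use fin in auto)
    also have "\<dots> = (if \<phi> \<in> edge_bijections c a then 3 ^ (card E - 1) else 0)"
    proof (cases "E - {a} \<subseteq> ?m ` (E - {c})")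
      case False
      then obtain e' where e': "e' \<in> E - {a}" "e' \<notin> ?m ` (E - {c})" by blast
      then have "?fib e' = {}" by blast
      then have "(\<Sum>j<3. G e' j) = 0" unfolding G_def by (simp only: prod.empty mult_1_right sum_cube_roots(1))
      then have "(\<Prod>e'\<in>E - {a}. \<Sum>j<3. G e' j) = 0" by (intro prod_zero[OF fin(2)] bexI[OF _ e'(1)])
      moreover have "\<phi> \<notin> edge_bijections c a"
        using e' unfolding edge_bijections_def bij_betw_def by blast
      ultimately show ?thesis by simp
    next
      case True
      have cards: "card (E - {a}) = card E - 1" "card (E - {c}) = card E - 1"
        using a c finite_E by simp_all
      have "card (?m ` (E - {c})) \<le> card (E - {a})"
        using card_image_le[OF fin(1), of ?m] cards by simp
      then have im: "?m ` (E - {c}) = E - {a}"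
        using card_seteq[OF _ True] fin(1) by simp
      then have inj: "inj_on ?m (E - {c})" using fin(1) cards by (intro eq_card_imp_inj_on) simp_all
      have bij: "bij_betw ?m (E - {c}) (E - {a})" using im inj by (simp add: bij_betw_def)
      have "(\<Prod>e'\<in>E - {a}. \<Sum>j<3. G e' j) = (\<Prod>e\<in>E - {c}. \<Sum>j<3. G (?m e) j)"
        by (rule prod.reindex_bij_betw[OF bij, symmetric])
      also have "\<dots> = (\<Prod>e\<in>E - {c}. if (\<alpha> e = \<alpha> c) = (\<alpha> (?m e) = \<alpha> a) then 3 else 0)"
      proof (rule prod.cong[OF refl])
        fix e assume e: "e \<in> E - {c}"
        then have "?fib (?m e) = {e}" using inj by (auto dest: inj_onD)
        then have "(\<Sum>j<3. G (?m e) j) = (\<Sum>j<3. ?k a (?m e) (cnj (cube_root ^ j)) * ?k c e (cube_root ^ j))"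
          by (simp only: G_def prod.insert[OF finite.emptyI] prod.empty empty_iff not_False_eq_True mult_1_right)
        also have "\<dots> = (if ((\<alpha> (?m e) = 0) \<noteq> (\<alpha> a = 0)) = ((\<alpha> e = 0) \<noteq> (\<alpha> c = 0)) then 3 else 0)"
          by (rule sum_cube_roots(2))
        also have "((\<alpha> (?m e) = 0) \<noteq> (\<alpha> a = 0)) = ((\<alpha> e = 0) \<noteq> (\<alpha> c = 0)) \<longleftrightarrow>
            (\<alpha> e = \<alpha> c) = (\<alpha> (?m e) = \<alpha> a)"
        proof -
          have "?m e \<in> E" "e \<in> E" using e sub by auto
          then show ?thesis
            using col_cases[of e] col_cases[of "?m e"] col_cases[OF a] col_cases[OF c] by auto
        qed
        finally show "(\<Sum>j<3. G (?m e) j) = (if (\<alpha> e = \<alpha> c) = (\<alpha> (?m e) = \<alpha> a) then 3 else 0)" .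
      qed
      also have "\<dots> = (if \<phi> \<in> edge_bijections c a then 3 ^ (card E - 1) else 0)"
      proof (cases "\<forall>e\<in>E. (\<alpha> e = \<alpha> c) = (\<alpha> (?m e) = \<alpha> a)")
        case True
        then have "\<phi> \<in> edge_bijections c a" using \<phi> \<phi>c bij by (simp only: edge_bijections_def) blast
        then show ?thesis using True cards by simp
      next
        case False
        then obtain e where e: "e \<in> E" "\<not> ((\<alpha> e = \<alpha> c) = (\<alpha> (?m e) = \<alpha> a))" by blast
        then have "e \<in> E - {c}" using \<phi>c by auto
        then have "(\<Prod>e\<in>E - {c}. if (\<alpha> e = \<alpha> c) = (\<alpha> (?m e) = \<alpha> a) then 3 else 0 :: complex) = 0"
          by (rule prod_zero[OF fin(1) bexI[rotated]]) (use e in simp)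
        moreover have "\<phi> \<notin> edge_bijections c a" using e unfolding edge_bijections_def by blast
        ultimately show ?thesis by simp
      qed
      finally show ?thesis .
    qed
    finally show ?thesis .
  qed
qed

text \<open>The map sends \<open>E\<close> onto \<open>E\<close>. Every vertex lies on an edge and
  every edge leads from \<open>A\<close> to \<open>B\<close>, so each class is mapped onto itself,
  bijectively by finiteness. Injectivity on the classes then shows that only edges are mapped to
  edges.\<close>

lemma edge_bijection_automorphism:
  assumes a: "a \<in> E" and c: "c \<in> E" and \<phi>: "\<phi> \<in> edge_bijections c a"
  shows "automorphism A B E \<phi>"
proof -
  let ?m = "map_prod \<phi> \<phi>"
  have bij: "bij_betw ?m (E - {c}) (E - {a})" and \<phi>c: "?m c = a"
    using \<phi> by (simp_all add: edge_bijections_def)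
  have im: "?m ` E = E"
  proof -
    have "?m ` E = insert (?m c) (?m ` (E - {c}))"
      by (subst image_insert[symmetric]) (simp only: insert_Diff[OF c])
    also have "\<dots> = E" using bij by (simp only: \<phi>c bij_betw_def insert_Diff[OF a])
    finally show ?thesis .
  qed
  have edge: "(\<phi> u, \<phi> v) \<in> E" if "(u, v) \<in> E" for u v
    using imageI[OF that, of ?m] unfolding im by simp
  have surj: "\<exists>u v. (u, v) \<in> E \<and> e = (\<phi> u, \<phi> v)" if "e \<in> E" for e
  proof -
    have "e \<in> ?m ` E" using im that by simp
    then show ?thesis by auto
  qed
  have inA: "\<exists>v. (u, v) \<in> E" if u: "u \<in> A" for u
  proof -
    obtain e where e: "e \<in> E" "u = fst e \<or> u = snd e"
      using bip u unfolding bipartite_graph_def by blast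
    moreover have "snd e \<in> B" using subsetD[OF E_sub e(1)] by (simp add: mem_Times_iff)
    ultimately have "(u, snd e) \<in> E" using u AB_disj by auto
    then show ?thesis by blast
  qed
  have inB: "\<exists>u. (u, v) \<in> E" if v: "v \<in> B" for v
  proof -
    obtain e where e: "e \<in> E" "v = fst e \<or> v = snd e"
      using bip v unfolding bipartite_graph_def by blast
    moreover have "fst e \<in> A" using subsetD[OF E_sub e(1)] by (simp add: mem_Times_iff)
    ultimately have "(fst e, v) \<in> E" using v AB_disj by auto
    then show ?thesis by blast
  qed
  have ends: "u \<in> A" "v \<in> B" if "(u, v) \<in> E" for u v using subsetD[OF E_sub that] by auto
  have finAB: "finite A" "finite B" using finite_AB by auto
  have "\<phi> ` A = A"
  proof (intro equalityI subsetI)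
    fix x assume "x \<in> \<phi> ` A"
    then obtain u where x: "x = \<phi> u" "u \<in> A" by blast
    then obtain v where "(u, v) \<in> E" using inA by blast
    then show "x \<in> A" using ends(1)[OF edge] x by simp
  next
    fix x assume "x \<in> A"
    then obtain y where "(x, y) \<in> E" using inA by blast
    then obtain u v where "(u, v) \<in> E" "(x, y) = (\<phi> u, \<phi> v)" using surj by blast
    then show "x \<in> \<phi> ` A" using ends(1) by auto
  qed
  then have bA: "bij_betw \<phi> A A" using finAB by (simp add: bij_betw_def eq_card_imp_inj_on)
  have "\<phi> ` B = B"
  proof (intro equalityI subsetI)
    fix x assume "x \<in> \<phi> ` B"
    then obtain v where x: "x = \<phi> v" "v \<in> B" by blast
    then obtain u where "(u, v) \<in> E" using inB by blast
    then show "x \<in> B" using ends(2)[OF edge] x by simp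
  next
    fix x assume "x \<in> B"
    then obtain y where "(y, x) \<in> E" using inB by blast
    then obtain u v where "(u, v) \<in> E" "(y, x) = (\<phi> u, \<phi> v)" using surj by blast
    then show "x \<in> \<phi> ` B" using ends(2) by auto
  qed
  then have bB: "bij_betw \<phi> B B" using finAB by (simp add: bij_betw_def eq_card_imp_inj_on)
  have "(u, v) \<in> E" if "u \<in> A" "v \<in> B" and uv: "(\<phi> u, \<phi> v) \<in> E" for u v
  proof -
    obtain u' v' where e: "(u', v') \<in> E" "\<phi> u = \<phi> u'" "\<phi> v = \<phi> v'" using surj[OF uv] by blast
    have "u' \<in> A" "v' \<in> B" using ends[OF e(1)] by auto
    then have "u = u'" "v = v'"
      using e that bA bB by (auto simp: bij_betw_def dest: inj_onD)
    then show ?thesis using e(1) by simp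
  qed
  then show ?thesis using bA bB edge unfolding automorphism_def by blast
qed

end

section \<open>Comparing the numbers of edge bijections\<close>

context norming_bigraph
begin

text \<open>Averaging the identity of \<open>slot_eq_slot\<close> over all \<open>\<zeta>\<close>
  with weights \<open>w \<zeta>\<close> shows that there are as many edge bijections from
  \<open>b\<close> to \<open>a\<close> as from \<open>a\<close> to \<open>a\<close>. The latter
  include the identity.\<close>

lemma edge_bijection_exists:
  assumes a: "a \<in> E" and b: "b \<in> E"
  shows "edge_bijections b a \<noteq> {}"
proof -
  let ?V = "A \<union> B"
  let ?P = "PiE ?V (\<lambda>_. ?V)"
  let ?k = "\<lambda>c e. conj_if ((\<alpha> e = 0) \<noteq> (\<alpha> c = 0))"
  \<comment> \<open>Vanishing off \<open>E\<close> kills every vertex map that sends one of the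
    remaining edges to a non-edge. The value 1 at \<open>a\<close> ensures a nonzero sum for every
    \<open>\<zeta>\<close>.\<close>
  define f where "f = (\<lambda>\<zeta> e. if e = a then 1 else if e \<in> E then cube_root ^ \<zeta> e else 0)"
  define w where "w = (\<lambda>\<zeta> :: 'v \<times> 'v \<Rightarrow> nat. \<Prod>e\<in>E - {a}. ?k a e (cnj (cube_root ^ \<zeta> e)))"
  define X where "X = (\<lambda>c \<zeta>. conj_if (\<alpha> c = 0) (slot ?V c (\<lambda>i j. f \<zeta> (i, j)) (\<lambda>i j. if (i, j) = a then 1 else 0)))"
  let ?Z = "PiE (E - {a}) (\<lambda>_. {..<3::nat})"
  have count: "(\<Sum>\<zeta>\<in>?Z. w \<zeta> * X c \<zeta>) = 3 ^ (card E - 1) * of_nat (card (edge_bijections c a))"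
    if c: "c \<in> E" for c
  proof -
    have X: "X c \<zeta> = (\<Sum>\<phi>\<in>?P. (if map_prod \<phi> \<phi> c = a then 1 else 0) *
        (\<Prod>e\<in>E - {c}. ?k c e (f \<zeta> (map_prod \<phi> \<phi> e))))" for \<zeta>
    proof -
      \<comment> \<open>The outer conjugation from \<open>c\<close> and the inner one from
        \<open>e\<close> cancel exactly when \<open>c\<close> and \<open>e\<close> have the same
        colour.\<close>
      have "conj_if (\<alpha> c = 0) (conj_if (\<alpha> e = 0) z) = ?k c e z" for e z
        by (auto simp: conj_if_def)
      moreover have "conj_if b (conj_if b (if Q then 1 else 0)) = (if Q then 1 else 0)" for b Q
        by (simp add: conj_if_def)
      moreover have "map_prod \<phi> \<phi> e = (\<phi> (fst e), \<phi> (snd e))" for \<phi> :: "'v \<Rightarrow> 'v" and e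
        by (cases e) simp
      ultimately show ?thesis
        by (simp only: X_def slot_eq[OF c] conj_if_sum conj_if_prod conj_if_mult)
    qed
    have "(\<Sum>\<zeta>\<in>?Z. w \<zeta> * X c \<zeta>) = (\<Sum>\<phi>\<in>?P. (if map_prod \<phi> \<phi> c = a then 1 else 0) *
        (\<Sum>\<zeta>\<in>?Z. w \<zeta> * (\<Prod>e\<in>E - {c}. ?k c e (f \<zeta> (map_prod \<phi> \<phi> e)))))"
      unfolding X sum_distrib_left by (subst sum.swap) (simp only: mult.left_commute)
    also have "\<dots> = (\<Sum>\<phi>\<in>?P. if \<phi> \<in> edge_bijections c a then 3 ^ (card E - 1) else 0)"
    proof (rule sum.cong[OF refl])
      fix \<phi> assume \<phi>: "\<phi> \<in> ?P"
      show "(if map_prod \<phi> \<phi> c = a then 1 else 0) *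
          (\<Sum>\<zeta>\<in>?Z. w \<zeta> * (\<Prod>e\<in>E - {c}. ?k c e (f \<zeta> (map_prod \<phi> \<phi> e))))
        = (if \<phi> \<in> edge_bijections c a then 3 ^ (card E - 1) else 0)"
      proof (cases "map_prod \<phi> \<phi> c = a")
        case True
        show ?thesis using sum_colourings[OF a c \<phi> True] unfolding w_def f_def by (simp only: True simp_thms if_True mult_1_left)
      next
        case False
        then have "\<phi> \<notin> edge_bijections c a" unfolding edge_bijections_def by blast
        then show ?thesis using False by simp
      qed
    qed
    also have "\<dots> = (\<Sum>\<phi>\<in>edge_bijections c a. 3 ^ (card E - 1))"
    proof -
      have "edge_bijections c a \<subseteq> ?P" unfolding edge_bijections_def by blast
      then show ?thesis using finite_maps[OF finite_AB] by (simp add: sum.If_cases Int_absorb1)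
    qed
    finally show ?thesis by (simp add: mult.commute)
  qed
  have "X a \<zeta> = X b \<zeta>" for \<zeta>
  proof -
    have "hom_sum ?V (\<lambda>i j. f \<zeta> (i, j)) \<noteq> 0"
      by (rule hom_sum_nonzero[OF finite_AB edge_ends[OF a]]) (simp add: f_def)
    moreover have "?V \<noteq> {}" using edge_ends[OF a] by blast
    ultimately show ?thesis unfolding X_def by (intro slot_eq_slot finite_AB a b)
  qed
  then have "(3 ^ (card E - 1) * of_nat (card (edge_bijections a a)) :: complex)
      = 3 ^ (card E - 1) * of_nat (card (edge_bijections b a))"
    using count[OF a] count[OF b] by simp
  then have "card (edge_bijections a a) = card (edge_bijections b a)" by simp
  moreover have "restrict id ?V \<in> edge_bijections a a"
  proof -
    have m: "map_prod (restrict id ?V) (restrict id ?V) e = e" if "e \<in> E" for e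
      using edge_ends[OF that] by (cases e) simp
    then have "bij_betw (map_prod (restrict id ?V) (restrict id ?V)) (E - {a}) (E - {a})"
      by (intro bij_betwI[where g = id]) auto
    then show ?thesis using m a unfolding edge_bijections_def by auto
  qed
  moreover have "finite (edge_bijections a a)"
    by (rule finite_subset[OF _ finite_maps[OF finite_AB]]) (auto simp: edge_bijections_def)
  ultimately show ?thesis by (metis card.empty card_0_eq empty_iff)
qed

text \<open>An edge bijection relates agreement with the colour of \<open>a\<close> to agreement of
  the image with the colour of \<open>b\<close>. With two colours this means preservation when
  \<open>a\<close> and \<open>b\<close> have the same colour and reversal otherwise.\<close>

lemma transitive: "transitive_colouring A B E \<alpha>"
  unfolding transitive_colouring_def
proof (intro conjI ballI impI balanced)
  fix a b assume a: "a \<in> E" and b: "b \<in> E"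
  obtain \<phi> where \<phi>: "\<phi> \<in> edge_bijections a b" using edge_bijection_exists[OF b a] by blast
  have aut: "automorphism A B E \<phi>" by (rule edge_bijection_automorphism[OF b a \<phi>])
  have ab: "map_prod \<phi> \<phi> a = b" and bij: "bij_betw (map_prod \<phi> \<phi>) (E - {a}) (E - {b})"
    and rel: "\<And>e. e \<in> E \<Longrightarrow> (\<alpha> e = \<alpha> a) = (\<alpha> (map_prod \<phi> \<phi> e) = \<alpha> b)"
    using \<phi> unfolding edge_bijections_def by blast+
  have col': "\<alpha> e = 0 \<or> \<alpha> e = 1" "\<alpha> (map_prod \<phi> \<phi> e) = 0 \<or> \<alpha> (map_prod \<phi> \<phi> e) = 1" if "e \<in> E" for e
  proof -
    have "map_prod \<phi> \<phi> e \<in> E" using that ab b bij_betwE[OF bij] by (cases "e = a") auto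
    then show "\<alpha> e = 0 \<or> \<alpha> e = 1" "\<alpha> (map_prod \<phi> \<phi> e) = 0 \<or> \<alpha> (map_prod \<phi> \<phi> e) = 1"
      using col_cases that by blast+
  qed
  show "\<exists>\<phi>. automorphism A B E \<phi> \<and> map_prod \<phi> \<phi> a = b \<and> preserves_colours E \<alpha> \<phi>" if eq: "\<alpha> a = \<alpha> b"
  proof -
    have "preserves_colours E \<alpha> \<phi>" unfolding preserves_colours_def
    proof
      fix e assume "e \<in> E"
      then show "\<alpha> (map_prod \<phi> \<phi> e) = \<alpha> e" using rel[of e] col'[of e] col'[OF a] eq by auto
    qed
    then show ?thesis using aut ab by blast
  qed
  show "\<exists>\<phi>. automorphism A B E \<phi> \<and> map_prod \<phi> \<phi> a = b \<and> reverses_colours E \<alpha> \<phi>" if ne: "\<alpha> a \<noteq> \<alpha> b"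
  proof -
    have "reverses_colours E \<alpha> \<phi>" unfolding reverses_colours_def
    proof
      fix e assume "e \<in> E"
      then show "\<alpha> (map_prod \<phi> \<phi> e) \<noteq> \<alpha> e"
        using rel[of e] col'[of e] col'[OF a] ne col_cases[OF b] by auto
    qed
    then show ?thesis using aut ab by blast
  qed
qed

end

theorem theorem4p3:
  fixes A B :: "'v set" and E :: "('v \<times> 'v) set" and \<alpha> :: "'v \<times> 'v \<Rightarrow> nat"
  assumes "bipartite_graph A B E"
    and "\<alpha> \<in> E \<rightarrow> {0, 1}"
    and "complex_norming A B E \<alpha>"
  shows "transitive_colouring A B E \<alpha>"
proof -
  interpret norming_bigraph A B E \<alpha>
    using assms by unfold_locales
  show ?thesis by (rule transitive)
qed

end
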